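(* Let $A$ be a $C^*$-algebra, let $I$ be a closed two-sided ideal of $A$, and let $a\in A$. Then $$\max\{r(a),\|\dot a\|\}=\inf\|(1+e)a(1+e)^{-1}\|,$$ where the infimum is taken over all $e\in I$ such that $1+e$ is invertible. Moreover, if $\|\dot a\|>r(a)$, then the infimum is attained.
   Context: $r(a)$ denotes the spectral radius of $a\in A$, and $\dot a$ denotes the image of $a$ under the canonical surjection $A\to A/I$; $\|\dot a\|$ is its norm in the quotient $C^*$-algebra $A/I$. The symbol $1$ denotes the unit of $A$ (or of the unitization of $A$ if $A$ is not unital), and invertibility of $1+e$ is understood there. *)

theory Defs
  imports "HOL-Analysis.Analysis"
begin

class cstar_algebra = real_normed_algebra + banach +
  fixes scaleC :: "complex \<Rightarrow> 'a \<Rightarrow> 'a" (infixr \<open>*\<^sub>C\<close> 75)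
    and star :: "'a \<Rightarrow> 'a"
  assumes scaleR_scaleC: "r *\<^sub>R x = complex_of_real r *\<^sub>C x"
    and scaleC_add_right: "c *\<^sub>C (x + y) = c *\<^sub>C x + c *\<^sub>C y"
    and scaleC_add_left: "(c + d) *\<^sub>C x = c *\<^sub>C x + d *\<^sub>C x"
    and scaleC_scaleC: "c *\<^sub>C (d *\<^sub>C x) = (c * d) *\<^sub>C x"
    and scaleC_one: "1 *\<^sub>C x = x"
    and mult_scaleC_left: "(c *\<^sub>C x) * y = c *\<^sub>C (x * y)"
    and mult_scaleC_right: "x * (c *\<^sub>C y) = c *\<^sub>C (x * y)"
    and norm_scaleC: "norm (c *\<^sub>C x) = cmod c * norm x"
    and star_add: "star (x + y) = star x + star y"
    and star_scaleC: "star (c *\<^sub>C x) = cnj c *\<^sub>C star x"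
    and star_mult: "star (x * y) = star y * star x"
    and star_star: "star (star x) = x"
    and cstar_identity: "norm (star x * x) = (norm x)\<^sup>2"

definition closed_two_sided_ideal :: "'a::cstar_algebra set \<Rightarrow> bool" where
  "closed_two_sided_ideal I \<longleftrightarrow>
     closed I \<and> 0 \<in> I \<and>
     (\<forall>x\<in>I. \<forall>y\<in>I. x + y \<in> I) \<and>
     (\<forall>c. \<forall>x\<in>I. c *\<^sub>C x \<in> I) \<and>
     (\<forall>b. \<forall>x\<in>I. b * x \<in> I \<and> x * b \<in> I)"

definition quotient_class :: "'a::cstar_algebra set \<Rightarrow> 'a \<Rightarrow> 'a set" where
  "quotient_class I a = {a + i | i. i \<in> I}"

definition quotient_norm :: "'a::cstar_algebra set \<Rightarrow> real" where
  "quotient_norm X = (INF x\<in>X. norm x)"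

definition is_unit_element :: "'a::cstar_algebra \<Rightarrow> bool" where
  "is_unit_element u \<longleftrightarrow> (\<forall>x. u * x = x \<and> x * u = x)"

definition unital :: "'a::cstar_algebra itself \<Rightarrow> bool" where
  "unital _ \<longleftrightarrow> (\<exists>u::'a. is_unit_element u)"

(* The algebra A+ in which units and inverses are taken is A itself if A is unital, and the
   unitization A + C1 otherwise. Both are realised inside the type of pairs (x, c), standing for
   x + c1: the carrier is A x {0} in the first case and everything in the second. Addition and
   subtraction are those of the product type. *)

definition plus_carrier :: "('a::cstar_algebra \<times> complex) set" where
  "plus_carrier = (if unital TYPE('a) then UNIV \<times> {0} else UNIV)"

definition plus_one :: "'a::cstar_algebra \<times> complex" where
  "plus_one = (if unital TYPE('a) then (THE u. is_unit_element u, 0) else (0, 1))"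

definition plus_embed :: "'a::cstar_algebra \<Rightarrow> 'a \<times> complex" where
  "plus_embed x = (x, 0)"

definition plus_scale ::
  "complex \<Rightarrow> 'a::cstar_algebra \<times> complex \<Rightarrow> 'a \<times> complex" where
  "plus_scale c z = (c *\<^sub>C fst z, c * snd z)"

definition plus_mult ::
  "'a::cstar_algebra \<times> complex \<Rightarrow> 'a \<times> complex \<Rightarrow> 'a \<times> complex" (infixl \<open>\<odot>\<close> 70) where
  "z \<odot> w = (fst z * fst w + snd z *\<^sub>C fst w + snd w *\<^sub>C fst z, snd z * snd w)"

(* The C*-norm of A+: the norm of left multiplication by z, as an operator on A. (The norm of
   the product type is not used.) *)
definition plus_norm :: "'a::cstar_algebra \<times> complex \<Rightarrow> real" where
  "plus_norm z = onorm (\<lambda>y. fst z * y + snd z *\<^sub>C y)"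

definition is_plus_inverse ::
  "'a::cstar_algebra \<times> complex \<Rightarrow> 'a \<times> complex \<Rightarrow> bool" where
  "is_plus_inverse z w \<longleftrightarrow> w \<in> plus_carrier \<and> z \<odot> w = plus_one \<and> w \<odot> z = plus_one"

definition plus_invertible :: "'a::cstar_algebra \<times> complex \<Rightarrow> bool" where
  "plus_invertible z \<longleftrightarrow> z \<in> plus_carrier \<and> (\<exists>w. is_plus_inverse z w)"

definition plus_inverse :: "'a::cstar_algebra \<times> complex \<Rightarrow> 'a \<times> complex" where
  "plus_inverse z = (THE w. is_plus_inverse z w)"

definition spectrum :: "'a::cstar_algebra \<Rightarrow> complex set" where
  "spectrum a = {c. \<not> plus_invertible (plus_scale c plus_one - plus_embed a)}"

(* The spectrum is empty only in the zero algebra; inserting 0 makes the spectral radius 0 there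
   and changes nothing otherwise. *)
definition spectral_radius :: "'a::cstar_algebra \<Rightarrow> real" where
  "spectral_radius a = Sup (insert 0 (cmod ` spectrum a))"

definition conjugate_by :: "'a::cstar_algebra \<Rightarrow> 'a \<Rightarrow> 'a \<times> complex" where
  "conjugate_by e a =
     (plus_one + plus_embed e) \<odot> plus_embed a \<odot> plus_inverse (plus_one + plus_embed e)"

lemma norm_star: "norm (star x) = norm (x::'a::cstar_algebra)"
proof -
  have le: "norm y \<le> norm (star y)" for y :: 'a
  proof (cases "norm y = 0")
    case False
    have "norm y * norm y \<le> norm (star y) * norm y"
      using norm_mult_ineq[of "star y" y] by (simp add: cstar_identity power2_eq_square)
    then show ?thesis
      using False by simp
  qed simp
  show ?thesis
    using le[of x] le[of "star x"] by (simp add: star_star)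
qed

lemma plus_norm_embed: "plus_norm (plus_embed x) = norm (x::'a::cstar_algebra)"
proof -
  have z: "0 *\<^sub>C y = 0" for y :: 'a
    using norm_scaleC[of 0 y] by simp
  have eq: "plus_norm (plus_embed x) = onorm (\<lambda>y. x * y)"
    by (simp add: plus_norm_def plus_embed_def z)
  have "norm x \<le> onorm (\<lambda>y. x * y)"
  proof (cases "norm x = 0")
    case True
    then show ?thesis
      by (simp add: onorm_pos_le bounded_linear_mult_right)
  next
    case False
    have "norm x * norm x = norm (x * star x)"
      using cstar_identity[of "star x"] by (simp add: star_star norm_star power2_eq_square)
    also have "\<dots> \<le> onorm (\<lambda>y. x * y) * norm x"
      using onorm[OF bounded_linear_mult_right, of x "star x"] by (simp add: norm_star)
    finally show ?thesis
      using False by simp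
  qed
  moreover have "onorm (\<lambda>y. x * y) \<le> norm x"
    by (rule onorm_bound) (simp_all add: norm_mult_ineq)
  ultimately show ?thesis
    using eq by simp
qed

end

theory Submission imports Defs begin

text \<open>Write \<open>t\<close> for a number with \<open>r(a) < t\<close> and \<open>\<parallel>a + I\<parallel> \<le> t\<close>, and scale so that \<open>t = 1\<close>. An
invertible \<open>x\<close> satisfies \<open>\<parallel>x a x\<^sup>-\<^sup>1\<parallel> \<le> 1\<close> as soon as \<open>h = x\<^sup>* x\<close> satisfies \<open>a\<^sup>* h a \<le> h\<close>, so the
problem is to find such an \<open>h\<close> in \<open>1 + I\<close> and to take \<open>x = h\<^sup>1\<^sup>/\<^sup>2\<close>. Since the image of \<open>a\<close> in \<open>A/I\<close>
is a contraction, the positive part \<open>p\<close> of \<open>a\<^sup>* a - 1\<close> lies in \<open>I\<close> (lemma \<open>excess_in_ideal\<close>).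
Since \<open>r(a) < 1\<close>, the powers of \<open>a\<close> decay geometrically and the series
\<open>h = 1 + p + a\<^sup>* p a + a\<^sup>*\<^sup>2 p a\<^sup>2 + \<dots>\<close>
converges to an element of \<open>1 + I\<close> with \<open>h \<ge> 1\<close>. It telescopes: \<open>h - a\<^sup>* h a = 1 + p - a\<^sup>* a\<close>, which is
the negative part of \<open>a\<^sup>* a - 1\<close> and therefore positive. Moreover \<open>x - 1 = (x + 1)\<^sup>-\<^sup>1 (h - 1)\<close> is in \<open>I\<close>.
This is lemma \<open>contractive_similarity\<close>. If \<open>\<parallel>a + I\<parallel> > r(a)\<close> then \<open>t = \<parallel>a + I\<parallel>\<close> is
admissible, which is why the infimum is attained in this case. The opposite inequality
is elementary, because \<open>x a x\<^sup>-\<^sup>1\<close> has the spectrum of \<open>a\<close> and lies in \<open>a + I\<close>.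

The argument takes place in a unital \<open>C\<^sup>*\<close>-algebra, namely \<open>A \<times> \<complex>\<close> with its \<open>C\<^sup>*\<close>-norm. This algebra is
used also if \<open>A\<close> has a unit: then it is the direct sum of \<open>A\<close> and \<open>\<complex>\<close>, and passing to it adds at most
the point \<open>0\<close> to a spectrum and does not change which elements \<open>1 + e\<close> with \<open>e \<in> I\<close> are invertible.

The theory of unital \<open>C\<^sup>*\<close>-algebras that the construction uses is built on three facts: the geometric
decay of powers outside the spectral radius (lemma \<open>power_bound\<close>), square roots of positive elements
(lemma \<open>sqrt_el\<close>), and the positivity of \<open>c\<^sup>* c\<close> (theorem \<open>pos_star_mult\<close>).\<close>

section \<open>Complex scalars and the involution\<close>

class unital_cstar_algebra = cstar_algebra + real_normed_algebra_1

lemma scaleC_zero_right [simp]: "c *\<^sub>C 0 = (0::'a::cstar_algebra)"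
  using norm_scaleC[of c "0::'a"] by simp

lemma scaleC_zero_left [simp]: "0 *\<^sub>C x = (0::'a::cstar_algebra)"
  using norm_scaleC[of 0 x] by simp

lemma scaleC_minus_left: "(- c) *\<^sub>C x = - (c *\<^sub>C (x::'a::cstar_algebra))"
  using scaleC_add_left[of "-c" c x] by (simp add: eq_neg_iff_add_eq_0)

lemma scaleC_minus_right: "c *\<^sub>C (- x) = - (c *\<^sub>C (x::'a::cstar_algebra))"
  using scaleC_add_right[of c "-x" x] by (simp add: eq_neg_iff_add_eq_0)

lemma scaleC_diff_left: "(c - d) *\<^sub>C x = c *\<^sub>C x - d *\<^sub>C (x::'a::cstar_algebra)"
  using scaleC_add_left[of c "-d" x] by (simp add: scaleC_minus_left)

lemma scaleC_diff_right: "c *\<^sub>C (x - y) = c *\<^sub>C x - c *\<^sub>C (y::'a::cstar_algebra)"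
  using scaleC_add_right[of c x "-y"] by (simp add: scaleC_minus_right)

lemmas scaleC_simps [simp] = scaleC_scaleC scaleC_one mult_scaleC_left mult_scaleC_right
  scaleC_minus_left scaleC_minus_right

lemma of_real_eq_scaleC: "(of_real t :: 'a::unital_cstar_algebra) = complex_of_real t *\<^sub>C 1"
  by (simp add: of_real_def scaleR_scaleC)

lemma scaleC_power: "(c *\<^sub>C x) ^ n = c ^ n *\<^sub>C (x::'a::unital_cstar_algebra) ^ n"
  by (induction n) (simp_all add: mult.commute)

lemma star_zero [simp]: "star 0 = (0::'a::cstar_algebra)"
  using star_add[of "0::'a" 0] by simp

lemma star_minus [simp]: "star (- x) = - star (x::'a::cstar_algebra)"
  using star_add[of "-x" x] by (simp add: eq_neg_iff_add_eq_0)

lemma star_diff: "star (x - y) = star x - star (y::'a::cstar_algebra)"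
  using star_add[of x "-y"] by simp

lemma star_scaleR: "star (r *\<^sub>R x) = r *\<^sub>R star (x::'a::cstar_algebra)"
  by (simp add: scaleR_scaleC star_scaleC)

lemma star_one [simp]: "star 1 = (1::'a::unital_cstar_algebra)"
  by (metis mult.left_neutral mult.right_neutral star_mult star_star)

lemma star_of_real [simp]: "star (of_real t) = (of_real t::'a::unital_cstar_algebra)"
  by (simp add: of_real_def star_scaleR)

lemma star_power: "star (x ^ n) = star (x::'a::unital_cstar_algebra) ^ n"
  by (induction n) (simp_all add: star_mult power_commutes)

lemma bounded_linear_star: "bounded_linear (star :: 'a::cstar_algebra \<Rightarrow> 'a)"
  by (rule bounded_linear_intro[where K=1]) (simp_all add: star_add star_scaleR norm_star)

lemma star_tendsto: "(f \<longlongrightarrow> l) F \<Longrightarrow> ((\<lambda>x. star (f x)) \<longlongrightarrow> star (l::'a::cstar_algebra)) F"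
  by (rule bounded_linear.tendsto[OF bounded_linear_star])

lemma norm_square_self_adjoint:
  "star x = x \<Longrightarrow> norm (x * x) = (norm (x::'a::cstar_algebra))\<^sup>2"
  using cstar_identity[of x] by simp

text \<open>Only the powers with exponent \<open>2\<^sup>k\<close> come directly from the \<open>C\<^sup>*\<close>-identity; they suffice to compare norm and
spectral radius.\<close>

lemma norm_dyadic_power_self_adjoint:
  fixes x :: "'a::unital_cstar_algebra"
  assumes "star x = x"
  shows "norm (x ^ 2 ^ k) = norm x ^ 2 ^ k"
proof (induction k)
  case (Suc k)
  have "norm (x ^ 2 ^ Suc k) = norm (x ^ 2 ^ k * x ^ 2 ^ k)"
    by (simp add: power_add[symmetric] mult_2)
  also have "\<dots> = (norm (x ^ 2 ^ k))\<^sup>2"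
    by (intro norm_square_self_adjoint) (simp add: star_power assms)
  finally show ?case
    using Suc by (simp add: power_mult[symmetric] mult.commute)
qed simp

section \<open>Inverses and spectra\<close>

definition has_inverse :: "'a::monoid_mult \<Rightarrow> bool" where
  "has_inverse x \<longleftrightarrow> (\<exists>v. x * v = 1 \<and> v * x = 1)"

definition inv_el :: "'a::monoid_mult \<Rightarrow> 'a" where
  "inv_el x = (SOME v. x * v = 1 \<and> v * x = 1)"

lemma has_inverseI: "x * v = 1 \<Longrightarrow> w * x = 1 \<Longrightarrow> has_inverse x"
  unfolding has_inverse_def by (metis mult.assoc mult.left_neutral mult.right_neutral)

lemma inv_el:
  assumes "has_inverse x"
  shows "x * inv_el x = 1" "inv_el x * x = 1"
  using someI_ex[OF assms[unfolded has_inverse_def]] by (simp_all add: inv_el_def)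

lemma inv_el_unique: "x * v = 1 \<Longrightarrow> v * x = 1 \<Longrightarrow> inv_el x = v"
  by (metis has_inverseI inv_el(2) mult.assoc mult.left_neutral mult.right_neutral)

lemma has_inverse_mult: "has_inverse x \<Longrightarrow> has_inverse y \<Longrightarrow> has_inverse (x * y)"
  by (rule has_inverseI[where v = "inv_el y * inv_el x" and w = "inv_el y * inv_el x"])
     (metis inv_el mult.assoc mult.right_neutral)+

text \<open>If \<open>w\<close> inverts \<open>x y = y x\<close>, then \<open>y w\<close> is a right inverse and \<open>w y\<close> a left inverse of \<open>x\<close>.\<close>

lemma has_inverse_factor:
  assumes "has_inverse (x * y)" "x * y = y * x"
  shows "has_inverse x"
proof (rule has_inverseI)
  show "x * (y * inv_el (x * y)) = 1"
    using inv_el(1)[OF assms(1)] by (simp add: mult.assoc)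
  show "(inv_el (x * y) * y) * x = 1"
    using inv_el(2)[OF assms(1)] assms(2) by (simp add: mult.assoc)
qed

lemma has_inverse_scaleC:
  fixes x :: "'a::unital_cstar_algebra"
  assumes "c \<noteq> 0" shows "has_inverse (c *\<^sub>C x) \<longleftrightarrow> has_inverse x"
proof -
  have *: "has_inverse (d *\<^sub>C y)" if "d \<noteq> 0" "has_inverse y" for d and y :: 'a
    using that inv_el[OF that(2)]
    by (intro has_inverseI[where v = "inverse d *\<^sub>C inv_el y" and w = "inverse d *\<^sub>C inv_el y"]) simp_all
  show ?thesis
    using *[of c x] *[of "inverse c" "c *\<^sub>C x"] assms by auto
qed

lemma has_inverse_minus: "has_inverse (- x) \<longleftrightarrow> has_inverse (x::'a::unital_cstar_algebra)"
  using has_inverse_scaleC[of "-1" x] by simp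

lemma has_inverse_one_minus:
  fixes x :: "'a::unital_cstar_algebra"
  assumes "norm x < 1"
  shows "has_inverse (1 - x)"
proof -
  have s: "summable (\<lambda>n. x ^ n)"
  proof (rule summable_comparison_test')
    show "summable (\<lambda>n. norm x ^ n)" using assms by (simp add: summable_geometric)
  qed (rule norm_power_ineq)
  let ?S = "\<Sum>n. x ^ n"
  have "?S = 1 + (\<Sum>n. x ^ Suc n)"
    using suminf_split_head[OF s] by simp
  moreover have "(\<Sum>n. x ^ Suc n) = x * ?S" "(\<Sum>n. x ^ Suc n) = ?S * x"
    using suminf_mult[OF s, of x] suminf_mult2[OF s, of x] by (simp_all add: power_commutes)
  ultimately have "?S = 1 + x * ?S" "?S = 1 + ?S * x" by simp_all
  then have "(1 - x) * ?S = 1" "?S * (1 - x) = 1"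
    by (metis add_diff_cancel_right' left_diff_distrib mult_1_left, metis add_diff_cancel_right' right_diff_distrib mult_1_right)
  then show ?thesis by (rule has_inverseI)
qed

definition spec :: "'a::unital_cstar_algebra \<Rightarrow> complex set" where
  "spec x = {c. \<not> has_inverse (c *\<^sub>C 1 - x)}"

lemma spec_norm_le:
  assumes "c \<in> spec x" shows "cmod c \<le> norm x"
proof (rule ccontr)
  assume a: "\<not> cmod c \<le> norm x"
  then have c: "c \<noteq> 0" by auto
  have "norm (inverse c *\<^sub>C x) < 1"
    using a c by (simp add: norm_scaleC norm_inverse norm_divide field_simps)
  then have "has_inverse (1 - inverse c *\<^sub>C x)" by (rule has_inverse_one_minus)
  then have "has_inverse (c *\<^sub>C (1 - inverse c *\<^sub>C x))"
    by (rule has_inverse_scaleC[OF c, THEN iffD2])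
  then show False
    using assms c by (simp add: spec_def scaleC_diff_right)
qed

lemma spec_scaleC:
  assumes "d \<noteq> 0" shows "c \<in> spec (d *\<^sub>C x) \<longleftrightarrow> c / d \<in> spec x"
proof -
  have "c *\<^sub>C 1 - d *\<^sub>C x = d *\<^sub>C ((c / d) *\<^sub>C 1 - x)"
    using assms by (simp add: scaleC_diff_right)
  then show ?thesis using assms by (simp add: spec_def has_inverse_scaleC)
qed

lemma spec_diff: "c \<in> spec (d *\<^sub>C 1 - x) \<longleftrightarrow> d - c \<in> spec x"
proof -
  have "c *\<^sub>C 1 - (d *\<^sub>C 1 - x) = - ((d - c) *\<^sub>C 1 - x)"
    by (simp add: scaleC_diff_left)
  then show ?thesis by (simp only: spec_def has_inverse_minus mem_Collect_eq)
qed

lemma spec_of_real_diff: "c \<in> spec (of_real t - x) \<longleftrightarrow> of_real t - c \<in> spec x"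
  by (simp add: of_real_eq_scaleC spec_diff)

section \<open>Decay of powers outside the spectral radius\<close>

text \<open>By the resolvent identity the difference of two resolvents is \<open>(c - d) R(c) x R(d)\<close>. Hence the resolvent
is continuous, so it is bounded on a compact disc, and then the same identity gives a Lipschitz constant.\<close>

lemma resolvent_lipschitz:
  fixes x :: "'a::unital_cstar_algebra"
  assumes inv: "\<And>c. cmod c \<le> \<rho> \<Longrightarrow> has_inverse (1 - c *\<^sub>C x)"
  shows "\<exists>L. \<forall>c d. cmod c \<le> \<rho> \<longrightarrow> cmod d \<le> \<rho> \<longrightarrow>
           norm (inv_el (1 - c *\<^sub>C x) - inv_el (1 - d *\<^sub>C x)) \<le> L * cmod (c - d)"
proof -
  define R where "R c = inv_el (1 - c *\<^sub>C x)" for c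
  note R = inv_el[OF inv, folded R_def]
  have res: "R c - R d = (c - d) *\<^sub>C (R c * x * R d)" if "cmod c \<le> \<rho>" "cmod d \<le> \<rho>" for c d
  proof -
    have "R c - R d = R c * ((1 - d *\<^sub>C x) - (1 - c *\<^sub>C x)) * R d"
    proof -
      have "R c * ((1 - d *\<^sub>C x) - (1 - c *\<^sub>C x)) * R d
          = R c * ((1 - d *\<^sub>C x) * R d) - (R c * (1 - c *\<^sub>C x)) * R d"
        by (simp only: left_diff_distrib right_diff_distrib mult.assoc)
      then show ?thesis
        by (simp only: R[OF that(1)] R[OF that(2)] mult_1_left mult_1_right)
    qed
    also have "(1 - d *\<^sub>C x) - (1 - c *\<^sub>C x) = (c - d) *\<^sub>C x"
      by (simp add: scaleC_diff_left)
    finally show ?thesis by simp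
  qed
  have res_le: "norm (R c - R d) \<le> cmod (c - d) * (norm (R c) * norm x * norm (R d))"
    if "cmod c \<le> \<rho>" "cmod d \<le> \<rho>" for c d
    unfolding res[OF that] norm_scaleC
    by (intro mult_left_mono order_trans[OF norm_mult_ineq] mult_right_mono norm_mult_ineq) simp_all
  have "continuous_on (cball 0 \<rho>) R"
    unfolding continuous_on_iff
  proof (intro ballI allI impI)
    fix d :: complex and \<epsilon> :: real
    assume "d \<in> cball 0 \<rho>" and \<epsilon>: "0 < \<epsilon>"
    then have d: "cmod d \<le> \<rho>" by simp
    define M where "M = norm x * norm (R d) + 1"
    define \<delta> where "\<delta> = min (1 / (2 * M)) (\<epsilon> / (2 * (norm (R d) + 1) * M))"
    have M: "M > 0" by (simp add: M_def add_nonneg_pos)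
    have \<delta>0: "\<delta> > 0"
      using M \<epsilon> by (simp add: \<delta>_def add_nonneg_pos)
    have "norm (R c - R d) < \<epsilon>" if c: "cmod c \<le> \<rho>" and cd: "cmod (c - d) < \<delta>" for c
    proof -
      have le: "norm (R c - R d) \<le> cmod (c - d) * M * norm (R c)"
      proof -
        have "norm (R c) * (norm x * norm (R d)) \<le> norm (R c) * M"
          by (intro mult_left_mono) (simp_all add: M_def)
        from mult_left_mono[OF this norm_ge_zero[of "c - d"]]
        show ?thesis
          using res_le[OF c d] by (simp add: algebra_simps)
      qed
      \<comment> \<open>This bound allows \<open>R c\<close> to be absorbed: it makes \<open>norm (R c)\<close> at most twice \<open>norm (R d)\<close>.\<close>
      have cM: "cmod (c - d) * M \<le> 1 / 2"
      proof -
        have "cmod (c - d) * M \<le> (1 / (2 * M)) * M"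
          using cd M by (intro mult_right_mono) (simp_all add: \<delta>_def)
        then show ?thesis using M by simp
      qed
      have "norm (R c - R d) \<le> 1 / 2 * norm (R c)"
        using le mult_right_mono[OF cM norm_ge_zero[of "R c"]] by linarith
      then have b: "norm (R c) \<le> 2 * norm (R d)"
        using norm_triangle_ineq2[of "R c" "R d"] by linarith
      have "norm (R c - R d) \<le> cmod (c - d) * M * (2 * norm (R d))"
        using le mult_left_mono[OF b, of "cmod (c - d) * M"] M by simp
      also have "\<dots> \<le> cmod (c - d) * M * (2 * (norm (R d) + 1))"
        using M by (intro mult_left_mono) simp_all
      also have "\<dots> < \<epsilon>"
      proof -
        have "cmod (c - d) < \<epsilon> / (2 * (norm (R d) + 1) * M)"
          using cd by (simp add: \<delta>_def)
        moreover have "2 * (norm (R d) + 1) * M > 0"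
          using M by (simp add: add_nonneg_pos)
        ultimately show ?thesis
          by (simp add: pos_less_divide_eq mult_ac)
      qed
      finally show ?thesis .
    qed
    then show "\<exists>\<delta>>0. \<forall>c\<in>cball 0 \<rho>. dist c d < \<delta> \<longrightarrow> dist (R c) (R d) < \<epsilon>"
      using \<delta>0 by (auto simp: dist_norm)
  qed
  then have "bounded (R ` cball 0 \<rho>)"
    by (intro compact_imp_bounded compact_continuous_image) simp_all
  then obtain K where K: "\<And>c. cmod c \<le> \<rho> \<Longrightarrow> norm (R c) \<le> K"
    unfolding bounded_iff by (metis imageI mem_cball_0)
  show ?thesis
  proof (intro exI allI impI)
    fix c d assume cd: "cmod c \<le> \<rho>" "cmod d \<le> \<rho>"
    have K0: "0 \<le> K" using K[OF cd(1)] norm_ge_zero order_trans by blast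
    have "norm (R c) * norm x * norm (R d) \<le> K * norm x * K"
      using K[OF cd(1)] K[OF cd(2)] K0 by (intro mult_mono) simp_all
    then have "cmod (c - d) * (norm (R c) * norm x * norm (R d)) \<le> cmod (c - d) * (K * norm x * K)"
      by (intro mult_left_mono) simp_all
    with res_le[OF cd]
    show "norm (inv_el (1 - c *\<^sub>C x) - inv_el (1 - d *\<^sub>C x)) \<le> (K * norm x * K) * cmod (c - d)"
      by (simp add: R_def mult.commute)
  qed
qed

text \<open>The Lipschitz constant does not deteriorate when \<open>c x\<close> is replaced by its power \<open>v\<^sup>2\<close>, where
\<open>v = (c x)^(2^k)\<close>: the inverse of \<open>1 - v\<^sup>2\<close> is the average of the inverses of \<open>1 - v\<close> and \<open>1 + v\<close>, and
\<open>1 + v\<close> is \<open>1 - v\<close> at the rotated point \<open>\<omega> c\<close>, where \<open>\<omega>^(2^k) = -1\<close>. This uniformity replaces the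
Laurent expansion of the resolvent in the spectral radius formula.\<close>

lemma dyadic_resolvent_lipschitz:
  fixes x :: "'a::unital_cstar_algebra"
  assumes inv: "\<forall>c. cmod c \<le> \<rho> \<longrightarrow> has_inverse (1 - c *\<^sub>C x)"
    and lip: "\<forall>c d. cmod c \<le> \<rho> \<longrightarrow> cmod d \<le> \<rho> \<longrightarrow>
           norm (inv_el (1 - c *\<^sub>C x) - inv_el (1 - d *\<^sub>C x)) \<le> L * cmod (c - d)"
  shows "(\<forall>c. cmod c \<le> \<rho> \<longrightarrow> has_inverse (1 - (c *\<^sub>C x) ^ 2 ^ k)) \<and>
         (\<forall>c d. cmod c \<le> \<rho> \<longrightarrow> cmod d \<le> \<rho> \<longrightarrow>
           norm (inv_el (1 - (c *\<^sub>C x) ^ 2 ^ k) - inv_el (1 - (d *\<^sub>C x) ^ 2 ^ k)) \<le> L * cmod (c - d))"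
proof (induction k)
  case 0
  then show ?case using inv lip by simp
next
  case (Suc k)
  define T where "T c = inv_el (1 - (c *\<^sub>C x) ^ 2 ^ k)" for c
  define \<omega> where "\<omega> = cis (pi / 2 ^ k)"
  have \<omega>1: "cmod \<omega> = 1" by (simp add: \<omega>_def)
  have "\<omega> ^ 2 ^ k = cis (real (2 ^ k) * (pi / 2 ^ k))"
    unfolding \<omega>_def by (rule Complex.DeMoivre)
  also have "real (2 ^ k) * (pi / 2 ^ k) = pi" by simp
  finally have \<omega>: "\<omega> ^ 2 ^ k = - 1" by (simp only: cis_pi)
  have neg: "((\<omega> * c) *\<^sub>C x) ^ 2 ^ k = - ((c *\<^sub>C x) ^ 2 ^ k)" for c
    by (simp add: scaleC_power power_mult_distrib \<omega>)
  have T: "(1 - (c *\<^sub>C x) ^ 2 ^ k) * T c = 1" "T c * (1 - (c *\<^sub>C x) ^ 2 ^ k) = 1"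
    "(1 + (c *\<^sub>C x) ^ 2 ^ k) * T (\<omega> * c) = 1" "T (\<omega> * c) * (1 + (c *\<^sub>C x) ^ 2 ^ k) = 1"
    if "cmod c \<le> \<rho>" for c
  proof -
    have h: "has_inverse (1 - (d *\<^sub>C x) ^ 2 ^ k)" if "cmod d \<le> \<rho>" for d
      using Suc that by blast
    have "cmod (\<omega> * c) \<le> \<rho>" using that \<omega>1 by (simp add: norm_mult)
    from inv_el[OF h[OF this]]
    show "(1 + (c *\<^sub>C x) ^ 2 ^ k) * T (\<omega> * c) = 1" "T (\<omega> * c) * (1 + (c *\<^sub>C x) ^ 2 ^ k) = 1"
      by (simp_all only: T_def neg diff_minus_eq_add)
    show "(1 - (c *\<^sub>C x) ^ 2 ^ k) * T c = 1" "T c * (1 - (c *\<^sub>C x) ^ 2 ^ k) = 1"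
      using inv_el[OF h[OF that]] by (simp_all only: T_def)
  qed
  have lipT: "norm (T c - T d) \<le> L * cmod (c - d)" if "cmod c \<le> \<rho>" "cmod d \<le> \<rho>" for c d
    using Suc that unfolding T_def by blast
  define S where "S c = (1 / 2) *\<^sub>R (T c + T (\<omega> * c))" for c
  have S: "(1 - (c *\<^sub>C x) ^ 2 ^ Suc k) * S c = 1" "S c * (1 - (c *\<^sub>C x) ^ 2 ^ Suc k) = 1"
    if c: "cmod c \<le> \<rho>" for c
  proof -
    define v where "v = (c *\<^sub>C x) ^ 2 ^ k"
    have sq: "(c *\<^sub>C x) ^ 2 ^ Suc k = v * v"
      by (simp add: v_def power_add[symmetric] mult_2)
    have f: "1 - v * v = (1 + v) * (1 - v)" "1 - v * v = (1 - v) * (1 + v)"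
      by (simp_all add: algebra_simps)
    note T' = T[OF c, folded v_def]
    have "(1 - v * v) * T c = 1 + v" "(1 - v * v) * T (\<omega> * c) = 1 - v"
      by (simp only: f(1) mult.assoc T'(1) mult_1_right, simp only: f(2) mult.assoc T'(3) mult_1_right)
    then show "(1 - (c *\<^sub>C x) ^ 2 ^ Suc k) * S c = 1"
      unfolding sq S_def by (simp add: distrib_left scaleR_2[symmetric])
    have "T c * (1 - v * v) = 1 + v" "T (\<omega> * c) * (1 - v * v) = 1 - v"
      by (simp only: f(2) mult.assoc[symmetric] T'(2) mult_1_left,
        simp only: f(1) mult.assoc[symmetric] T'(4) mult_1_left)
    then show "S c * (1 - (c *\<^sub>C x) ^ 2 ^ Suc k) = 1"
      unfolding sq S_def by (simp add: distrib_right scaleR_2[symmetric])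
  qed
  have lipS: "norm (S c - S d) \<le> L * cmod (c - d)" if cd: "cmod c \<le> \<rho>" "cmod d \<le> \<rho>" for c d
  proof -
    have "norm (T (\<omega> * c) - T (\<omega> * d)) \<le> L * cmod (\<omega> * c - \<omega> * d)"
      using cd \<omega>1 by (intro lipT) (simp_all add: norm_mult)
    also have "cmod (\<omega> * c - \<omega> * d) = cmod (c - d)"
      using \<omega>1 by (metis norm_mult mult_1_left right_diff_distrib)
    finally have 2: "norm (T (\<omega> * c) - T (\<omega> * d)) \<le> L * cmod (c - d)" .
    have "S c - S d = (1 / 2) *\<^sub>R ((T c - T d) + (T (\<omega> * c) - T (\<omega> * d)))"
      by (simp add: S_def algebra_simps)
    then have "norm (S c - S d) \<le> 1 / 2 * (norm (T c - T d) + norm (T (\<omega> * c) - T (\<omega> * d)))"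
      using norm_triangle_ineq[of "T c - T d" "T (\<omega> * c) - T (\<omega> * d)"] by simp
    then show ?thesis using 2 lipT[OF cd] by simp
  qed
  show ?case
    using S lipS has_inverseI[OF S] inv_el_unique[OF S] by simp
qed

lemma norm_power_two_le:
  fixes v :: "'a::unital_cstar_algebra"
  assumes "norm v \<le> 1 / 2"
  shows "norm (v ^ 2 ^ j) \<le> (1 / 2) ^ j"
proof -
  have "norm (v ^ 2 ^ j) \<le> (1 / 2) ^ 2 ^ j"
    by (rule order_trans[OF norm_power_ineq power_mono[OF assms norm_ge_zero]])
  also have "\<dots> \<le> (1 / 2) ^ j"
    by (intro power_decreasing) (simp_all add: less_imp_le)
  finally show ?thesis .
qed

text \<open>If the powers of \<open>c x\<close> tend to \<open>0\<close>, then the inverse of \<open>1 - (c x)^(2^m)\<close> is close to \<open>1\<close> for large \<open>m\<close>.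
By the uniform Lipschitz bound the inverse of \<open>1 - (d x)^(2^m)\<close> is not far from \<open>1\<close>, so \<open>(d x)^(2^m)\<close> is small.\<close>

lemma small_power_step:
  fixes x :: "'a::unital_cstar_algebra"
  assumes inv: "\<forall>c. cmod c \<le> \<rho> \<longrightarrow> has_inverse (1 - c *\<^sub>C x)"
    and lip: "\<forall>c d. cmod c \<le> \<rho> \<longrightarrow> cmod d \<le> \<rho> \<longrightarrow>
           norm (inv_el (1 - c *\<^sub>C x) - inv_el (1 - d *\<^sub>C x)) \<le> L * cmod (c - d)"
    and cd: "cmod c \<le> \<rho>" "cmod d \<le> \<rho>" "L * cmod (c - d) \<le> 1 / 6"
    and small: "norm ((c *\<^sub>C x) ^ 2 ^ k) \<le> 1 / 2"
  shows "\<exists>m. norm ((d *\<^sub>C x) ^ 2 ^ m) \<le> 1 / 2"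
proof -
  \<comment> \<open>Three squarings turn the bound \<open>1/2\<close> into \<open>1/8\<close>, which is small enough for the final bound \<open>1/2\<close>.\<close>
  define m where "m = k + 3"
  define v w where "v = (c *\<^sub>C x) ^ 2 ^ m" and "w = (d *\<^sub>C x) ^ 2 ^ m"
  define T U where "T = inv_el (1 - v)" and "U = inv_el (1 - w)"
  note dy = dyadic_resolvent_lipschitz[where k = m, OF inv lip]
  have "v = ((c *\<^sub>C x) ^ 2 ^ k) ^ 2 ^ 3"
    by (simp add: v_def m_def power_add power_mult)
  then have v: "norm v \<le> 1 / 8"
    using norm_power_two_le[OF small, of 3] by (simp add: power3_eq_cube)
  have iv: "has_inverse (1 - v)" "has_inverse (1 - w)"
    using dy cd unfolding v_def w_def by blast+
  have TU: "norm (T - U) \<le> 1 / 6"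
    unfolding v_def w_def T_def U_def
    by (rule order_trans[OF dy[THEN conjunct2, rule_format, OF cd(1,2)] cd(3)])
  have "T - T * v = 1"
    using inv_el(2)[OF iv(1), folded T_def] by (simp add: right_diff_distrib)
  then have "T - 1 = T * v"
    by (metis add_diff_cancel_left' diff_add_cancel)
  then have "norm (T - 1) \<le> (1 + norm (T - 1)) * (1 / 8)"
  proof -
    have "norm (T * v) \<le> norm T * norm v" by (rule norm_mult_ineq)
    also have "norm T \<le> 1 + norm (T - 1)"
      using norm_triangle_ineq[of 1 "T - 1"] by simp
    finally have "norm (T * v) \<le> (1 + norm (T - 1)) * norm v"
      by (simp add: mult_right_mono)
    also have "\<dots> \<le> (1 + norm (T - 1)) * (1 / 8)"
      using v by (intro mult_left_mono) simp_all
    finally show ?thesis using \<open>T - 1 = T * v\<close> by simp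
  qed
  then have "norm (T - 1) \<le> 1 / 7" by simp
  then have U: "norm (U - 1) \<le> 1 / 3"
    using TU norm_triangle_ineq[of "T - 1" "U - T"] by (simp add: norm_minus_commute)
  have "w = (1 - w) * (U - 1)"
    using inv_el(1)[OF iv(2)] by (simp add: U_def right_diff_distrib)
  then have "norm w \<le> norm (1 - w) * norm (U - 1)"
    by (metis norm_mult_ineq)
  also have "\<dots> \<le> (1 + norm w) * (1 / 3)"
    using U norm_triangle_ineq4[of 1 w] by (intro mult_mono) simp_all
  finally have "norm w \<le> 1 / 2" by simp
  then show ?thesis unfolding w_def by blast
qed

text \<open>The hard half of the spectral radius formula. The property that some dyadic power of \<open>c x\<close> has norm at
most \<open>1/2\<close> holds for \<open>c = 0\<close> and spreads along the segment from \<open>0\<close> to \<open>1/s\<close> in finitely many steps of a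
length that depends only on the Lipschitz constant.\<close>

lemma power_halved_of_resolvent:
  fixes x :: "'a::unital_cstar_algebra"
  assumes s: "s > 0" and inv: "\<And>c. cmod c \<ge> s \<Longrightarrow> c \<notin> spec x"
  shows "\<exists>k. norm (x ^ 2 ^ k) \<le> s ^ 2 ^ k / 2"
proof -
  have inv': "has_inverse (1 - c *\<^sub>C x)" if c: "cmod c \<le> 1 / s" for c
  proof (cases "c = 0")
    case False
    then have "has_inverse (inverse c *\<^sub>C 1 - x)"
      using inv[of "inverse c"] c s False by (simp add: spec_def norm_inverse norm_divide field_simps)
    then have "has_inverse (c *\<^sub>C (inverse c *\<^sub>C 1 - x))"
      by (rule has_inverse_scaleC[OF False, THEN iffD2])
    then show ?thesis using False by (simp add: scaleC_diff_right)
  qed (simp add: has_inverse_def)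
  then have inv'': "\<forall>c. cmod c \<le> 1 / s \<longrightarrow> has_inverse (1 - c *\<^sub>C x)" by blast
  obtain L where L: "\<forall>c d. cmod c \<le> 1 / s \<longrightarrow> cmod d \<le> 1 / s \<longrightarrow>
           norm (inv_el (1 - c *\<^sub>C x) - inv_el (1 - d *\<^sub>C x)) \<le> L * cmod (c - d)"
    using resolvent_lipschitz[of "1 / s" x] inv' by blast
  obtain N where N: "of_nat N > 6 * \<bar>L\<bar> / s + 1"
    using reals_Archimedean2 by blast
  then have N0: "real N > 0"
    using s by (smt (verit) divide_nonneg_pos abs_ge_zero)
  have "j \<le> N \<Longrightarrow> \<exists>k. norm ((complex_of_real (real j / (real N * s)) *\<^sub>C x) ^ 2 ^ k) \<le> 1 / 2" for j
  proof (induction j)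
    case 0
    show ?case by (rule exI[of _ 0]) simp
  next
    case (Suc j)
    let ?c = "complex_of_real (real j / (real N * s))"
    let ?d = "complex_of_real (real (Suc j) / (real N * s))"
    have le: "cmod (complex_of_real (real i / (real N * s))) \<le> 1 / s" if "i \<le> N" for i
      using that s N0 unfolding norm_of_real by (simp add: field_simps abs_of_pos)
    have "?c - ?d = complex_of_real (- 1 / (real N * s))"
      unfolding of_real_diff[symmetric]
      by (rule arg_cong[where f = complex_of_real]) (simp add: add_divide_distrib)
    then have "cmod (?c - ?d) = 1 / (real N * s)"
      using s N0 by (simp only: norm_of_real) (simp add: abs_of_pos)
    moreover have "L * (1 / (real N * s)) \<le> 1 / 6"
    proof -
      have "6 * \<bar>L\<bar> / s \<le> real N" using N by simp
      then have "6 * \<bar>L\<bar> \<le> real N * s" using s by (simp add: field_simps)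
      then have "6 * L \<le> real N * s" by linarith
      then show ?thesis using s N0 by (simp add: field_simps)
    qed
    ultimately have "L * cmod (?c - ?d) \<le> 1 / 6" by simp
    moreover obtain k where "norm ((?c *\<^sub>C x) ^ 2 ^ k) \<le> 1 / 2"
      using Suc by auto
    ultimately show ?case
      using small_power_step[OF inv'' L le[of j] le[of "Suc j"]] Suc.prems by auto
  qed
  from this[of N] obtain k where
    k: "norm ((complex_of_real (1 / s) *\<^sub>C x) ^ 2 ^ k) \<le> 1 / 2"
    using N0 by auto
  then have "norm (x ^ 2 ^ k) / s ^ 2 ^ k \<le> 1 / 2"
    using s by (simp add: scaleC_power norm_scaleC norm_power norm_divide power_divide)
  then show ?thesis using s by (auto simp: field_simps)
qed

text \<open>For a suitable \<open>m\<close>, passing from \<open>x^n\<close> to \<open>x^(n + m)\<close> multiplies the norm by at most \<open>s^m\<close>, so \<open>C\<close> has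
to account only for the exponents below \<open>m\<close>.\<close>

lemma power_bound:
  fixes x :: "'a::unital_cstar_algebra"
  assumes s: "s > 0" and inv: "\<And>c. cmod c \<ge> s \<Longrightarrow> c \<notin> spec x"
  shows "\<exists>C. \<forall>n. norm (x ^ n) \<le> C * s ^ n"
proof -
  obtain k where k: "norm (x ^ 2 ^ k) \<le> s ^ 2 ^ k / 2"
    using power_halved_of_resolvent[OF assms] by blast
  define m :: nat where "m = 2 ^ k"
  have m: "m > 0" "norm (x ^ m) \<le> s ^ m" using order_trans[OF k, of "s ^ 2 ^ k"] s by (simp_all add: m_def)
  define C where "C = (\<Sum>i<m. norm (x ^ i) / s ^ i)"
  have "norm (x ^ n) \<le> C * s ^ n" for n
  proof (induction n rule: less_induct)
    case (less n)
    show ?case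
    proof (cases "n < m")
      case True
      have "norm (x ^ n) / s ^ n \<le> C"
        unfolding C_def using True s by (intro member_le_sum) (simp_all add: zero_le_divide_iff)
      then show ?thesis using s by (simp add: field_simps)
    next
      case False
      have "norm (x ^ n) = norm (x ^ (n - m) * x ^ m)"
        using False by (simp add: power_add[symmetric])
      also have "\<dots> \<le> norm (x ^ (n - m)) * norm (x ^ m)" by (rule norm_mult_ineq)
      also have "\<dots> \<le> (C * s ^ (n - m)) * s ^ m"
        using less[of "n - m"] m False s by (intro mult_mono) (simp_all add: order_trans[OF norm_ge_zero])
      also have "\<dots> = C * s ^ n"
        using False by (simp add: power_add[symmetric])
      finally show ?thesis .
    qed
  qed
  then show ?thesis by blast
qed

section \<open>Self-adjoint and positive elements\<close>

text \<open>If \<open>c\<close> is in the spectrum of \<open>x\<close>, then \<open>c + \<i> t\<close> is in the spectrum of \<open>x + \<i> t\<close>, whose squared norm is at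
most \<open>\<parallel>x\<parallel>\<^sup>2 + t\<^sup>2\<close> by the \<open>C\<^sup>*\<close>-identity. Since \<open>|c + \<i> t|\<^sup>2 = |c|\<^sup>2 + 2 t Im c + t\<^sup>2\<close>,
the number \<open>2 t Im c\<close> is at most \<open>\<parallel>x\<parallel>\<^sup>2\<close> for every real \<open>t\<close>.\<close>

lemma spec_self_adjoint_real:
  fixes x :: "'a::unital_cstar_algebra"
  assumes sa: "star x = x" and c: "c \<in> spec x"
  shows "Im c = 0"
proof (rule ccontr)
  assume ne: "Im c \<noteq> 0"
  have main: "(Re c)\<^sup>2 + (Im c + t)\<^sup>2 \<le> (norm x)\<^sup>2 + t\<^sup>2" for t :: real
  proof -
    define y where "y = x + (\<i> * of_real t) *\<^sub>C 1"
    have "(c + \<i> * of_real t) *\<^sub>C 1 - y = c *\<^sub>C 1 - x"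
      by (simp add: y_def scaleC_add_left)
    then have "c + \<i> * of_real t \<in> spec y" using c by (simp add: spec_def)
    then have "(cmod (c + \<i> * of_real t))\<^sup>2 \<le> (norm y)\<^sup>2"
      by (intro power_mono spec_norm_le) simp_all
    also have "\<dots> = norm (star y * y)" by (simp add: cstar_identity)
    also have "star y * y = x * x + of_real (t\<^sup>2)"
    proof -
      have "star y = x - (\<i> * of_real t) *\<^sub>C 1"
        by (simp add: y_def star_add star_scaleC sa)
      moreover have i: "\<i> * of_real t * (\<i> * of_real t) = - (of_real t * of_real t)"
        by (simp add: complex_eq_iff)
      ultimately have "star y * y = (x - (\<i> * of_real t) *\<^sub>C 1) * (x + (\<i> * of_real t) *\<^sub>C 1)"
        by (simp only: y_def)
      then show ?thesis
        by (simp add: left_diff_distrib right_diff_distrib distrib_left distrib_right scaleC_add_right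
            scaleC_diff_right of_real_eq_scaleC power2_eq_square i)
    qed
    also have "norm (x * x + of_real (t\<^sup>2)) \<le> norm (x * x) + t\<^sup>2"
      by (metis norm_triangle_ineq norm_of_real abs_power2)
    also have "\<dots> = (norm x)\<^sup>2 + t\<^sup>2" by (simp add: norm_square_self_adjoint sa)
    finally show ?thesis by (simp add: cmod_power2)
  qed
  have "2 * Im c * t \<le> (norm x)\<^sup>2" for t
    using main[of t] zero_le_power2[of "Re c"] zero_le_power2[of "Im c"]
    unfolding power2_sum by linarith
  from this[of "((norm x)\<^sup>2 + 1) / (2 * Im c)"] show False
    using ne by simp
qed

text \<open>A self-adjoint element has norm equal to its spectral radius, because the norms of its dyadic powers
are exactly the powers of its norm and the decay of powers applies to them.\<close>

lemma norm_le_spec_bound: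
  fixes x :: "'a::unital_cstar_algebra"
  assumes sa: "star x = x" and s: "s \<ge> 0" and bd: "\<And>c. c \<in> spec x \<Longrightarrow> cmod c \<le> s"
  shows "norm x \<le> s"
proof (rule dense_ge)
  fix r assume r: "s < r"
  have "\<exists>k. norm (x ^ 2 ^ k) \<le> r ^ 2 ^ k / 2"
  proof (rule power_halved_of_resolvent)
    show "r > 0" using r s by simp
    show "c \<notin> spec x" if "r \<le> cmod c" for c
      using bd[of c] that r by linarith
  qed
  then obtain k where k: "norm x ^ 2 ^ k \<le> r ^ 2 ^ k / 2"
    unfolding norm_dyadic_power_self_adjoint[OF sa] by blast
  have "0 < r ^ 2 ^ k" using r s by simp
  then have "norm x ^ 2 ^ k < r ^ 2 ^ k" using k by linarith
  moreover have "0 \<le> r" using r s by simp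
  ultimately have "norm x < r" by (rule power_less_imp_less_base)
  then show "norm x \<le> r" by simp
qed

text \<open>For self-adjoint \<open>x\<close> the inequality puts the spectrum into \<open>[0, 2 t]\<close>. This form of positivity makes sums
immediate; the lemmas \<open>pos_spec\<close> and \<open>posI\<close> translate to and from the spectrum.\<close>

definition pos :: "'a::unital_cstar_algebra \<Rightarrow> bool" where
  "pos x \<longleftrightarrow> star x = x \<and> (\<exists>t. norm (of_real t - x) \<le> t)"

lemma pos_star: "pos x \<Longrightarrow> star x = x"
  by (simp add: pos_def)

lemma pos_add:
  assumes "pos x" "pos y" shows "pos (x + y)"
proof -
  obtain s t where st: "norm (of_real s - x) \<le> s" "norm (of_real t - y) \<le> t"
    using assms by (auto simp: pos_def)
  have "norm (of_real (s + t) - (x + y)) \<le> s + t"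
    using norm_triangle_ineq[of "of_real s - x" "of_real t - y"] st by (simp add: algebra_simps)
  moreover have "star (x + y) = x + y" using assms by (simp add: pos_def star_add)
  ultimately show ?thesis unfolding pos_def by blast
qed

lemma pos_spec:
  assumes "pos x" "c \<in> spec x"
  shows "Im c = 0" "Re c \<ge> 0"
proof -
  show im: "Im c = 0" using assms spec_self_adjoint_real by (auto simp: pos_def)
  obtain t where t: "norm (of_real t - x) \<le> t" using assms by (auto simp: pos_def)
  have "of_real t - c \<in> spec (of_real t - x)" using assms by (simp add: spec_of_real_diff)
  then have "cmod (of_real t - c) \<le> t" using t spec_norm_le order_trans by blast
  then show "Re c \<ge> 0" using complex_Re_le_cmod[of "of_real t - c"] by simp
qed

lemma posI_norm:
  fixes x :: "'a::unital_cstar_algebra"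
  assumes sa: "star x = x" and c: "\<And>c. c \<in> spec x \<Longrightarrow> Re c \<ge> 0" and T: "T \<ge> norm x"
  shows "norm (of_real T - x) \<le> T"
proof (rule norm_le_spec_bound)
  show "star (of_real T - x) = of_real T - x" by (simp add: star_diff sa)
  show "0 \<le> T" using T norm_ge_zero order_trans by blast
  fix d assume "d \<in> spec (of_real T - x)"
  then have d: "of_real T - d \<in> spec x" by (simp add: spec_of_real_diff)
  from spec_self_adjoint_real[OF sa d] have "Im d = 0" by simp
  moreover have "Re d \<le> T" using c[OF d] by simp
  moreover have "T - Re d \<le> T"
    using spec_norm_le[OF d] T complex_Re_le_cmod[of "of_real T - d"] by simp
  ultimately show "cmod d \<le> T" by (simp add: cmod_eq_Re)
qed

lemma posI:
  fixes x :: "'a::unital_cstar_algebra"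
  assumes "star x = x" "\<And>c. c \<in> spec x \<Longrightarrow> Re c \<ge> 0"
  shows "pos x"
  using assms posI_norm[OF assms order_refl] by (auto simp: pos_def)

lemma pos_norm:
  assumes "pos x" "T \<ge> norm x" shows "norm (of_real T - x) \<le> T"
  using assms by (intro posI_norm pos_spec) (auto simp: pos_def)

lemma pos_limit:
  fixes f :: "nat \<Rightarrow> 'a::unital_cstar_algebra"
  assumes f: "\<And>n. pos (f n)" and l: "f \<longlonglongrightarrow> l"
  shows "pos l"
proof -
  have "f \<longlonglongrightarrow> star l" using star_tendsto[OF l] by (simp add: pos_star[OF f])
  then have "star l = l" using l by (rule LIMSEQ_unique)
  moreover obtain T where T: "\<And>n. norm (f n) \<le> T"
    using l by (meson Bseq_def convergentI convergent_imp_Bseq)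
  have "norm (of_real T - l) \<le> T"
  proof (rule LIMSEQ_le_const2[where X = "\<lambda>n. norm (of_real T - f n)"])
    show "(\<lambda>n. norm (of_real T - f n)) \<longlonglongrightarrow> norm (of_real T - l)"
      by (intro tendsto_intros l)
    show "\<exists>N. \<forall>n\<ge>N. norm (of_real T - f n) \<le> T"
      using pos_norm[OF f T] by blast
  qed
  ultimately show ?thesis by (auto simp: pos_def)
qed

text \<open>The spectrum of \<open>x\<close> lies in \<open>[0, s]\<close>.\<close>

lemma norm_le_of_pos:
  assumes x: "pos x" and sx: "pos (of_real s - x)" and s: "s \<ge> 0"
  shows "norm x \<le> s"
proof (rule norm_le_spec_bound[OF pos_star[OF x] s])
  fix c assume c: "c \<in> spec x"
  have "of_real s - c \<in> spec (of_real s - x)"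
    using c by (simp add: spec_of_real_diff)
  from pos_spec[OF x c] pos_spec[OF sx this] show "cmod c \<le> s"
    by (simp add: cmod_eq_Re)
qed

text \<open>For \<open>c < 0\<close> with square root \<open>d\<close>, which is imaginary, \<open>c - x\<^sup>2 = (d - x) (d + x)\<close> is invertible.\<close>

lemma pos_square:
  fixes x :: "'a::unital_cstar_algebra"
  assumes sa: "star x = x"
  shows "pos (x * x)"
proof (rule posI)
  show sa2: "star (x * x) = x * x" by (simp add: star_mult sa)
  fix c assume c: "c \<in> spec (x * x)"
  have im: "Im c = 0" using spec_self_adjoint_real[OF sa2 c] .
  show "Re c \<ge> 0"
  proof (rule ccontr)
    assume neg: "\<not> Re c \<ge> 0"
    define d where "d = \<i> * of_real (sqrt (- Re c))"
    have dd: "d * d = c"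
      using neg im by (simp add: d_def complex_eq_iff)
    have "Im d \<noteq> 0" "Im (- d) \<noteq> 0" using neg by (simp_all add: d_def)
    then have "d \<notin> spec x" "- d \<notin> spec x"
      using spec_self_adjoint_real[OF sa] by blast+
    then have "has_inverse ((d *\<^sub>C 1 - x) * - (- d *\<^sub>C 1 - x))"
      unfolding spec_def by (intro has_inverse_mult) (simp_all only: has_inverse_minus, simp_all)
    moreover have "(d *\<^sub>C 1 - x) * - (- d *\<^sub>C 1 - x) = c *\<^sub>C 1 - x * x"
      by (simp add: left_diff_distrib right_diff_distrib distrib_left distrib_right scaleC_diff_right dd)
    ultimately show False using c by (simp add: spec_def)
  qed
qed

lemma pos_one: "pos (1::'a::unital_cstar_algebra)"
  using pos_square[of 1] by simp

section \<open>Square roots\<close>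

text \<open>The iteration solves \<open>y = (z + y\<^sup>2) / 2\<close>, that is, \<open>(1 - y)\<^sup>2 = 1 - z\<close>. Its terms are polynomials in \<open>z\<close> and
so inherit every commutation relation, self-adjointness, and congruence modulo an ideal.\<close>

primrec sqrt_iter :: "'a::unital_cstar_algebra \<Rightarrow> nat \<Rightarrow> 'a" where
  "sqrt_iter z 0 = 0"
| "sqrt_iter z (Suc n) = (1 / 2) *\<^sub>R (z + sqrt_iter z n * sqrt_iter z n)"

lemma sqrt_iter_commute:
  "b * z = z * b \<Longrightarrow> b * sqrt_iter z n = sqrt_iter z n * b"
proof (induction n)
  case (Suc n)
  then have "b * (sqrt_iter z n * sqrt_iter z n) = (sqrt_iter z n * sqrt_iter z n) * b"
    by (metis mult.assoc)
  then show ?case using Suc by (simp add: distrib_left distrib_right)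
qed simp

lemma sqrt_iter_star: "star z = z \<Longrightarrow> star (sqrt_iter z n) = sqrt_iter z n"
  by (induction n) (simp_all add: star_scaleR star_add star_mult)

text \<open>The same iteration for the number \<open>z = 1\<close>. It increases and stays below \<open>1\<close>, and it dominates the
iteration for every \<open>z\<close> in the closed unit ball, including its boundary, where no contraction argument applies.\<close>

primrec sqrt_majorant :: "nat \<Rightarrow> real" where
  "sqrt_majorant 0 = 0"
| "sqrt_majorant (Suc n) = (1 + (sqrt_majorant n)\<^sup>2) / 2"

lemma sqrt_majorant_bounds: "0 \<le> sqrt_majorant n \<and> sqrt_majorant n \<le> 1"
  by (induction n) (auto simp: power_le_one add_nonneg_nonneg)

lemma sqrt_majorant_mono: "sqrt_majorant n \<le> sqrt_majorant (Suc n)"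
  using zero_le_power2[of "sqrt_majorant n - 1"] by (simp add: power2_diff)

lemma sqrt_iter_norm:
  assumes "norm z \<le> 1"
  shows "norm (sqrt_iter z n) \<le> sqrt_majorant n"
proof (induction n)
  case (Suc n)
  have "norm (sqrt_iter z n * sqrt_iter z n) \<le> sqrt_majorant n * sqrt_majorant n"
    using Suc sqrt_majorant_bounds[of n]
    by (intro order_trans[OF norm_mult_ineq] mult_mono) simp_all
  then show ?case
    using norm_triangle_ineq[of z "sqrt_iter z n * sqrt_iter z n"] assms
    by (simp add: power2_eq_square)
qed simp

lemma sqrt_iter_step:
  assumes z: "norm z \<le> 1"
  shows "norm (sqrt_iter z (Suc n) - sqrt_iter z n) \<le> sqrt_majorant (Suc n) - sqrt_majorant n"
proof (induction n)
  case 0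
  then show ?case using z by simp
next
  case (Suc n)
  let ?y = "sqrt_iter z (Suc n)" and ?w = "sqrt_iter z n"
  have "z * ?w = ?w * z" by (intro sqrt_iter_commute) simp
  then have com: "?w * ?y = ?y * ?w" by (intro sqrt_iter_commute) simp
  have "sqrt_iter z (Suc (Suc n)) - ?y = (1 / 2) *\<^sub>R (?y * ?y - ?w * ?w)"
    by (simp only: sqrt_iter.simps(2)[of z "Suc n"] sqrt_iter.simps(2)[of z n, symmetric])
       (simp add: algebra_simps)
  also have "?y * ?y - ?w * ?w = (?y - ?w) * (?y + ?w)"
    using com by (simp only: left_diff_distrib distrib_left) (simp only: add_diff_eq diff_diff_eq2 diff_add_eq, simp)
  finally have "norm (sqrt_iter z (Suc (Suc n)) - ?y) = 1 / 2 * norm ((?y - ?w) * (?y + ?w))"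
    by simp
  also have "\<dots> \<le> 1 / 2 * ((sqrt_majorant (Suc n) - sqrt_majorant n) * (sqrt_majorant (Suc n) + sqrt_majorant n))"
    using Suc sqrt_iter_norm[OF z, of "Suc n"] sqrt_iter_norm[OF z, of n] sqrt_majorant_mono[of n]
      norm_triangle_ineq[of ?y ?w]
    by (intro mult_left_mono order_trans[OF norm_mult_ineq] mult_mono) (linarith | simp)+
  also have "\<dots> = ((sqrt_majorant (Suc n))\<^sup>2 - (sqrt_majorant n)\<^sup>2) / 2"
    by (simp only: power2_eq_square) (simp add: algebra_simps)
  also have "\<dots> = sqrt_majorant (Suc (Suc n)) - sqrt_majorant (Suc n)"
    by (simp only: sqrt_majorant.simps(2)[of "Suc n"] sqrt_majorant.simps(2)[of n]) (simp add: field_simps)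
  finally show ?case .
qed

definition sqrt_lim :: "'a::unital_cstar_algebra \<Rightarrow> 'a" where
  "sqrt_lim z = lim (sqrt_iter z)"

lemma sqrt_lim:
  fixes z :: "'a::unital_cstar_algebra"
  assumes z: "norm z \<le> 1"
  shows "sqrt_iter z \<longlonglongrightarrow> sqrt_lim z"
proof -
  have "summable (\<lambda>n. sqrt_majorant (Suc n) - sqrt_majorant n)"
  proof -
    have "incseq sqrt_majorant" by (rule incseq_SucI) (rule sqrt_majorant_mono)
    then have "convergent sqrt_majorant"
      using sqrt_majorant_bounds incseq_convergent[of sqrt_majorant 1] by (metis convergentI)
    then show ?thesis unfolding convergent_LIMSEQ_iff by (rule telescope_summable)
  qed
  then have "summable (\<lambda>n. sqrt_iter z (Suc n) - sqrt_iter z n)"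
    by (rule summable_comparison_test') (rule sqrt_iter_step[OF z])
  then have "convergent (\<lambda>n. \<Sum>k<n. sqrt_iter z (Suc k) - sqrt_iter z k)"
    by (simp only: summable_iff_convergent)
  then have "convergent (sqrt_iter z)"
    by (simp only: sum_lessThan_telescope) simp
  then show ?thesis by (simp add: sqrt_lim_def convergent_LIMSEQ_iff)
qed

lemma sqrt_lim_square:
  assumes z: "norm z \<le> 1"
  shows "(1 - sqrt_lim z) * (1 - sqrt_lim z) = 1 - z"
proof -
  note l = sqrt_lim[OF z]
  have "(\<lambda>n. sqrt_iter z (Suc n)) \<longlonglongrightarrow> (1 / 2) *\<^sub>R (z + sqrt_lim z * sqrt_lim z)"
    unfolding sqrt_iter.simps by (intro tendsto_intros l)
  with LIMSEQ_Suc[OF l] have "sqrt_lim z = (1 / 2) *\<^sub>R (z + sqrt_lim z * sqrt_lim z)"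
    by (rule LIMSEQ_unique)
  then have "2 *\<^sub>R sqrt_lim z = z + sqrt_lim z * sqrt_lim z"
    by (metis (no_types) scaleR_scaleR mult.commute scaleR_one nonzero_eq_divide_eq zero_neq_numeral)
  then show ?thesis by (simp add: algebra_simps scaleR_2)
qed

lemma sqrt_lim_star: "norm z \<le> 1 \<Longrightarrow> star z = z \<Longrightarrow> star (sqrt_lim z) = sqrt_lim z"
  by (rule LIMSEQ_unique[OF _ sqrt_lim])
     (use star_tendsto[OF sqrt_lim, of z] in \<open>simp_all add: sqrt_iter_star\<close>)

lemma sqrt_lim_commute:
  assumes "norm z \<le> 1" "b * z = z * b"
  shows "b * sqrt_lim z = sqrt_lim z * b"
proof (rule LIMSEQ_unique)
  show "(\<lambda>n. b * sqrt_iter z n) \<longlonglongrightarrow> b * sqrt_lim z"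
    by (intro tendsto_intros sqrt_lim assms)
  show "(\<lambda>n. b * sqrt_iter z n) \<longlonglongrightarrow> sqrt_lim z * b"
    unfolding sqrt_iter_commute[OF assms(2)] by (intro tendsto_intros sqrt_lim assms)
qed

lemma sqrt_lim_norm:
  assumes "norm z \<le> 1" shows "norm (sqrt_lim z) \<le> 1"
proof (rule LIMSEQ_le_const2[OF tendsto_norm[OF sqrt_lim[OF assms]]])
  show "\<exists>N. \<forall>n\<ge>N. norm (sqrt_iter z n) \<le> 1"
    using sqrt_iter_norm[OF assms] sqrt_majorant_bounds order_trans by blast
qed

section \<open>Closed ideals and congruence of square roots\<close>

lemma ideal_closed: "closed_two_sided_ideal I \<Longrightarrow> closed I"
  and ideal_zero: "closed_two_sided_ideal I \<Longrightarrow> 0 \<in> I"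
  and ideal_add: "closed_two_sided_ideal I \<Longrightarrow> x \<in> I \<Longrightarrow> y \<in> I \<Longrightarrow> x + y \<in> I"
  and ideal_scaleC: "closed_two_sided_ideal I \<Longrightarrow> x \<in> I \<Longrightarrow> c *\<^sub>C x \<in> I"
  and ideal_mult_left: "closed_two_sided_ideal I \<Longrightarrow> x \<in> I \<Longrightarrow> b * x \<in> I"
  and ideal_mult_right: "closed_two_sided_ideal I \<Longrightarrow> x \<in> I \<Longrightarrow> x * b \<in> I"
  by (simp_all add: closed_two_sided_ideal_def)

lemma ideal_scaleR: "closed_two_sided_ideal I \<Longrightarrow> x \<in> I \<Longrightarrow> r *\<^sub>R x \<in> I"
  by (simp add: scaleR_scaleC ideal_scaleC)

lemma ideal_minus: "closed_two_sided_ideal I \<Longrightarrow> x \<in> I \<Longrightarrow> - x \<in> I"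
  using ideal_scaleC[of I x "-1"] by simp

lemma ideal_diff: "closed_two_sided_ideal I \<Longrightarrow> x \<in> I \<Longrightarrow> y \<in> I \<Longrightarrow> x - y \<in> I"
  using ideal_add[of I x "-y"] ideal_minus[of I y] by simp

lemma ideal_mult_cong:
  assumes I: "closed_two_sided_ideal I" and "x - x' \<in> I" "y - y' \<in> I"
  shows "x * y - x' * y' \<in> I"
proof -
  have "x * y - x' * y' = x * (y - y') + (x - x') * y'" by (simp add: algebra_simps)
  then show ?thesis using assms by (simp add: ideal_add ideal_mult_left ideal_mult_right)
qed

lemma sqrt_iter_cong:
  assumes I: "closed_two_sided_ideal I" and z: "z - w \<in> I"
  shows "sqrt_iter z n - sqrt_iter w n \<in> I"
proof (induction n)
  case (Suc n)
  have "sqrt_iter z (Suc n) - sqrt_iter w (Suc n) = (1 / 2) *\<^sub>R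
      ((z - w) + (sqrt_iter z n * sqrt_iter z n - sqrt_iter w n * sqrt_iter w n))"
    by (simp add: algebra_simps)
  then show ?case
    using ideal_scaleR[OF I] ideal_add[OF I z] ideal_mult_cong[OF I Suc Suc] by simp
qed (simp add: ideal_zero[OF I])

lemma sqrt_lim_cong:
  assumes I: "closed_two_sided_ideal I" and z: "z - w \<in> I" and n: "norm z \<le> 1" "norm w \<le> 1"
  shows "sqrt_lim z - sqrt_lim w \<in> I"
  by (rule closed_sequentially[OF ideal_closed[OF I], where f = "\<lambda>n. sqrt_iter z n - sqrt_iter w n"])
     (use sqrt_iter_cong[OF I z] in \<open>auto intro!: tendsto_diff sqrt_lim n\<close>)

text \<open>The square root of \<open>x = t (1 - z)\<close>. The parameter \<open>t\<close> is kept so that square roots of two congruent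
elements can be formed by the same sequence of polynomials and compared modulo an ideal.\<close>

definition sqrt_el :: "real \<Rightarrow> 'a::unital_cstar_algebra \<Rightarrow> 'a" where
  "sqrt_el t x = sqrt t *\<^sub>R (1 - sqrt_lim (1 - (1 / t) *\<^sub>R x))"

lemma sqrt_el_arg:
  fixes x :: "'a::unital_cstar_algebra"
  assumes "t > 0" "norm (of_real t - x) \<le> t"
  shows "norm (1 - (1 / t) *\<^sub>R x) \<le> 1"
proof -
  have "1 - (1 / t) *\<^sub>R x = (1 / t) *\<^sub>R (of_real t - x)"
    using assms by (simp add: scaleR_diff_right of_real_def)
  then show ?thesis using assms by simp
qed

text \<open>The square root is positive because its distance from \<open>sqrt t\<close> is at most \<open>sqrt t\<close>, the limit of the
iteration being in the unit ball.\<close>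

lemma sqrt_el:
  fixes x :: "'a::unital_cstar_algebra"
  assumes t: "t > 0" and x: "norm (of_real t - x) \<le> t" and sa: "star x = x"
  shows "sqrt_el t x * sqrt_el t x = x" "pos (sqrt_el t x)"
    "b * x = x * b \<Longrightarrow> b * sqrt_el t x = sqrt_el t x * b"
proof -
  note n = sqrt_el_arg[OF t x]
  show "sqrt_el t x * sqrt_el t x = x"
    using t by (simp add: sqrt_el_def sqrt_lim_square[OF n])
  have "star (sqrt_el t x) = sqrt_el t x"
    by (simp add: sqrt_el_def star_scaleR star_diff sqrt_lim_star[OF n] sa)
  moreover have "of_real (sqrt t) - sqrt_el t x = sqrt t *\<^sub>R sqrt_lim (1 - (1 / t) *\<^sub>R x)"
    by (simp add: sqrt_el_def scaleR_diff_right of_real_def)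
  then have "norm (of_real (sqrt t) - sqrt_el t x) \<le> sqrt t"
    using t sqrt_lim_norm[OF n] by (simp add: mult_left_le)
  ultimately show "pos (sqrt_el t x)" by (auto simp: pos_def)
  show "b * sqrt_el t x = sqrt_el t x * b" if "b * x = x * b"
    using sqrt_lim_commute[OF n, of b] that
    by (simp add: sqrt_el_def left_diff_distrib right_diff_distrib)
qed

lemma sqrt_el_cong:
  fixes x :: "'a::unital_cstar_algebra"
  assumes I: "closed_two_sided_ideal I" and xy: "x - y \<in> I" and t: "t > 0"
    and n: "norm (of_real t - x) \<le> t" "norm (of_real t - y) \<le> t"
  shows "sqrt_el t x - sqrt_el t y \<in> I"
proof -
  have "(1 - (1 / t) *\<^sub>R x) - (1 - (1 / t) *\<^sub>R y) = (- 1 / t) *\<^sub>R (x - y)"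
    by (simp add: algebra_simps)
  then have "(1 - (1 / t) *\<^sub>R x) - (1 - (1 / t) *\<^sub>R y) \<in> I"
    by (simp only: ideal_scaleR[OF I xy])
  then have "sqrt_lim (1 - (1 / t) *\<^sub>R x) - sqrt_lim (1 - (1 / t) *\<^sub>R y) \<in> I"
    by (intro sqrt_lim_cong I sqrt_el_arg t n)
  moreover have "sqrt_el t x - sqrt_el t y =
      (- sqrt t) *\<^sub>R (sqrt_lim (1 - (1 / t) *\<^sub>R x) - sqrt_lim (1 - (1 / t) *\<^sub>R y))"
    by (simp add: sqrt_el_def algebra_simps)
  ultimately show ?thesis by (metis ideal_scaleR[OF I])
qed

lemma pos_sqrt:
  assumes "pos x"
  obtains q where "pos q" "q * q = x" "\<And>b. b * x = x * b \<Longrightarrow> b * q = q * b"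
proof -
  have "norm (of_real (norm x + 1) - x) \<le> norm x + 1" using assms by (intro pos_norm) simp_all
  moreover have "norm x + 1 > 0" by (simp add: add_nonneg_pos)
  ultimately show ?thesis using sqrt_el pos_star[OF assms] that by metis
qed

section \<open>Positive and negative parts\<close>

text \<open>Here \<open>t\<close> is any positive bound for \<open>\<parallel>y\<parallel>\<^sup>2\<close>, as in \<open>pos_neg_part\<close>.\<close>

definition abs_el :: "real \<Rightarrow> 'a::unital_cstar_algebra \<Rightarrow> 'a" where
  "abs_el t y = sqrt_el t (y * y)"
definition pos_part :: "real \<Rightarrow> 'a::unital_cstar_algebra \<Rightarrow> 'a" where
  "pos_part t y = (1 / 2) *\<^sub>R (abs_el t y + y)"
definition neg_part :: "real \<Rightarrow> 'a::unital_cstar_algebra \<Rightarrow> 'a" where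
  "neg_part t y = (1 / 2) *\<^sub>R (abs_el t y - y)"

text \<open>Since \<open>(c - p) (c - n) = c (c - (p + n))\<close>, the factor \<open>c - p\<close> is invertible if \<open>c - (p + n)\<close> is; the same holds
with \<open>- n\<close> in place of \<open>n\<close>.\<close>

lemma spec_disjoint_sum:
  fixes p n :: "'a::unital_cstar_algebra"
  assumes pn: "p * n = 0" "n * p = 0" and c: "c \<in> spec p" "c \<noteq> 0"
  shows "c \<in> spec (p - n)" "c \<in> spec (p + n)"
proof -
  have f: "c \<in> spec (p + m)" if m: "p * m = 0" "m * p = 0" for m
  proof (rule ccontr)
    assume "c \<notin> spec (p + m)"
    then have "has_inverse (c *\<^sub>C (c *\<^sub>C 1 - (p + m)))"
      using c by (simp add: spec_def has_inverse_scaleC del: scaleC_simps)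
    moreover have "(c *\<^sub>C 1 - p) * (c *\<^sub>C 1 - m) = c *\<^sub>C (c *\<^sub>C 1 - (p + m))"
      "(c *\<^sub>C 1 - m) * (c *\<^sub>C 1 - p) = c *\<^sub>C (c *\<^sub>C 1 - (p + m))"
      using m by (simp_all add: algebra_simps scaleC_diff_right scaleC_add_right)
    ultimately have "has_inverse (c *\<^sub>C 1 - p)"
      by (intro has_inverse_factor[of "c *\<^sub>C 1 - p" "c *\<^sub>C 1 - m"]) simp_all
    then show False using c by (simp add: spec_def)
  qed
  show "c \<in> spec (p - n)" using f[of "- n"] pn by simp
  show "c \<in> spec (p + n)" using f[of n] pn by simp
qed

text \<open>The two parts annihilate each other because \<open>|y|\<close> commutes with \<open>y\<close> and has the same square, and they
are positive because their nonzero spectrum is contained in that of their sum \<open>|y|\<close>.\<close>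

lemma pos_neg_part:
  fixes y :: "'a::unital_cstar_algebra"
  assumes sa: "star y = y" and t: "t > 0" "t \<ge> (norm y)\<^sup>2"
  shows "pos (pos_part t y)" "pos (neg_part t y)" "pos_part t y - neg_part t y = y"
    "pos_part t y * neg_part t y = 0" "neg_part t y * pos_part t y = 0"
    "b * y = y * b \<Longrightarrow> b * neg_part t y = neg_part t y * b"
proof -
  let ?p = "pos_part t y" and ?n = "neg_part t y" and ?m = "abs_el t y"
  have yy: "pos (y * y)" by (rule pos_square[OF sa])
  have nn: "norm (of_real t - y * y) \<le> t"
    by (rule pos_norm[OF yy]) (use t in \<open>simp add: norm_square_self_adjoint sa\<close>)
  note m = sqrt_el[OF t(1) nn pos_star[OF yy], folded abs_el_def]
  show d: "?p - ?n = y"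
    by (simp add: pos_part_def neg_part_def algebra_simps scaleR_add_left[symmetric])
  have s: "?p + ?n = ?m"
    by (simp add: pos_part_def neg_part_def algebra_simps scaleR_add_left[symmetric])
  have com: "y * ?m = ?m * y" by (intro m(3)) (simp add: mult.assoc)
  show pn: "?p * ?n = 0" "?n * ?p = 0"
    by (simp_all add: pos_part_def neg_part_def algebra_simps com m(1))
  have sap: "star ?p = ?p" "star ?n = ?n"
    by (simp_all add: pos_part_def neg_part_def star_scaleR star_add star_diff sa pos_star[OF m(2)])
  show "pos ?p"
  proof (rule posI[OF sap(1)])
    fix c assume "c \<in> spec ?p"
    then show "0 \<le> Re c"
      using spec_disjoint_sum(2)[OF pn] pos_spec(2)[OF m(2)] s by (cases "c = 0") auto
  qed
  show "pos ?n"
  proof (rule posI[OF sap(2)])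
    fix c assume "c \<in> spec ?n"
    then show "0 \<le> Re c"
      using spec_disjoint_sum(2)[OF pn(2,1)] pos_spec(2)[OF m(2)] s
      by (cases "c = 0") (auto simp: add.commute)
  qed
  show "b * ?n = ?n * b" if "b * y = y * b"
  proof -
    have "b * ?m = ?m * b" using that by (intro m(3)) (metis mult.assoc)
    then show ?thesis using that by (simp add: neg_part_def left_diff_distrib right_diff_distrib)
  qed
qed

lemma pos_part_cong:
  assumes I: "closed_two_sided_ideal I" and xy: "x - y \<in> I" and sa: "star x = x" "star y = y"
    and t: "t > 0" "t \<ge> (norm x)\<^sup>2" "t \<ge> (norm y)\<^sup>2"
  shows "pos_part t x - pos_part t y \<in> I"
proof -
  have n: "norm (of_real t - u * u) \<le> t" if "star u = u" "t \<ge> (norm u)\<^sup>2" for u :: 'a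
    by (rule pos_norm[OF pos_square]) (use that in \<open>simp_all add: norm_square_self_adjoint\<close>)
  have "abs_el t x - abs_el t y \<in> I" unfolding abs_el_def
    by (rule sqrt_el_cong[OF I ideal_mult_cong[OF I xy xy] t(1)]) (use n sa t in auto)
  then have "(1 / 2) *\<^sub>R ((abs_el t x - abs_el t y) + (x - y)) \<in> I"
    by (intro ideal_scaleR[OF I] ideal_add[OF I] xy)
  then show ?thesis by (simp add: pos_part_def algebra_simps)
qed

text \<open>The nonzero spectrum of the positive part is contained in that of \<open>y\<close>.\<close>

lemma pos_part_norm:
  fixes y :: "'a::unital_cstar_algebra"
  assumes sa: "star y = y" and t: "t > 0" "t \<ge> (norm y)\<^sup>2"
    and e: "e \<ge> 0" and le: "pos (of_real e - y)"
  shows "norm (pos_part t y) \<le> e"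
proof -
  note p = pos_neg_part[OF sa t]
  show ?thesis
  proof (rule norm_le_spec_bound[OF pos_star[OF p(1)] e])
    fix c assume c: "c \<in> spec (pos_part t y)"
    show "cmod c \<le> e"
    proof (cases "c = 0")
      case False
      have "c \<in> spec y"
        using spec_disjoint_sum(1)[OF p(4,5) c False] p(3) by simp
      then have "of_real e - c \<in> spec (of_real e - y)" by (simp add: spec_of_real_diff)
      from pos_spec[OF p(1) c] pos_spec[OF le this] show ?thesis by (simp add: cmod_eq_Re)
    qed (simp add: e)
  qed
qed

section \<open>Positivity of c* c\<close>

text \<open>If \<open>v\<close> inverts \<open>c - y x\<close>, then \<open>(1 + x v y) / c\<close> inverts \<open>c - x y\<close>.\<close>

lemma spec_mult_swap:
  fixes x y :: "'a::unital_cstar_algebra"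
  assumes "c \<in> spec (x * y)" "c \<noteq> 0"
  shows "c \<in> spec (y * x)"
proof (rule ccontr)
  assume "c \<notin> spec (y * x)"
  then have "has_inverse (c *\<^sub>C 1 - y * x)" by (simp add: spec_def)
  then obtain v where v: "(c *\<^sub>C 1 - y * x) * v = 1" "v * (c *\<^sub>C 1 - y * x) = 1"
    by (auto simp: has_inverse_def)
  have e1: "y * (x * v) = c *\<^sub>C v - 1" and e2: "v * (y * x) = c *\<^sub>C v - 1"
    using v by (simp_all add: algebra_simps)
  define w where "w = 1 + x * v * y"
  have "x * y * (x * v * y) = x * (y * (x * v)) * y" by (simp add: mult.assoc)
  then have a: "x * y * (x * v * y) = c *\<^sub>C (x * v * y) - x * y"
    by (simp add: e1 algebra_simps)
  have "(x * v * y) * (x * y) = x * (v * (y * x)) * y" by (simp add: mult.assoc)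
  then have b: "(x * v * y) * (x * y) = c *\<^sub>C (x * v * y) - x * y"
    by (simp add: e2 algebra_simps)
  have "(c *\<^sub>C 1 - x * y) * w = c *\<^sub>C 1" "w * (c *\<^sub>C 1 - x * y) = c *\<^sub>C 1"
    unfolding w_def using a b
    by (simp_all add: left_diff_distrib right_diff_distrib distrib_left distrib_right scaleC_add_right)
  then have "(c *\<^sub>C 1 - x * y) * (inverse c *\<^sub>C w) = 1" "(inverse c *\<^sub>C w) * (c *\<^sub>C 1 - x * y) = 1"
    using assms(2) by simp_all
  then show False using assms(1) has_inverseI unfolding spec_def by blast
qed

text \<open>Let \<open>k\<close> be the negative part of \<open>x = c\<^sup>* c\<close> and \<open>d = c k\<close>. Then \<open>d\<^sup>* d = -k\<^sup>3\<close> is negative. The sum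
of \<open>d\<^sup>* d\<close> and \<open>d d\<^sup>*\<close> is a sum of squares of self-adjoint elements, so \<open>d d\<^sup>*\<close> is positive; but it has
the same nonzero spectrum as \<open>d\<^sup>* d\<close>. So \<open>d\<^sup>* d\<close> is both positive and negative, and \<open>k = 0\<close>.\<close>

theorem pos_star_mult:
  fixes c :: "'a::unital_cstar_algebra"
  shows "pos (star c * c)"
proof -
  define x where "x = star c * c"
  have sa: "star x = x" by (simp add: x_def star_mult star_star)
  define t where "t = (norm x)\<^sup>2 + 1"
  have t: "t > 0" "t \<ge> (norm x)\<^sup>2" by (simp_all add: t_def add_nonneg_pos)
  note pn = pos_neg_part[OF sa t]
  define k where "k = neg_part t x"
  have kx: "k * x = - (k * k)" 
    using pn(3,5) by (metis add.right_neutral k_def mult_zero_right right_diff_distrib diff_0)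
  obtain q where q: "pos q" "q * q = k" "\<And>b. b * k = k * b \<Longrightarrow> b * q = q * b"
    using pos_sqrt[OF pn(2)] unfolding k_def by metis
  have sk: "star k = k" and sq: "star q = q"
    using pn(2) q(1) by (simp_all add: k_def pos_star)
  define d where "d = c * k"
  have dd: "star d * d = - (k * k * k)"
  proof -
    have "star d * d = k * x * k" by (simp add: d_def star_mult sk x_def mult.assoc)
    then show ?thesis by (simp add: kx)
  qed
  have k3: "pos (k * k * k)"
  proof -
    have "k * k * k = (k * q) * (k * q)"
      using q(2) q(3)[of k] by (metis mult.assoc)
    moreover have "star (k * q) = k * q"
      using q(3)[of k] by (simp add: star_mult sk sq)
    ultimately show ?thesis using pos_square[of "k * q"] by simp
  qed
  \<comment> \<open>The real and imaginary parts of \<open>d\<close>.\<close>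
  define u v where "u = (1 / 2) *\<^sub>R (d + star d)" and "v = (- \<i> / 2) *\<^sub>C (d - star d)"
  have su: "star u = u" by (simp add: u_def star_scaleR star_add star_star add.commute)
  have sv: "star v = v"
    by (simp add: v_def star_scaleC star_diff star_star scaleC_diff_right scaleC_minus_left)
  have "d * star d = (u * u + u * u) + (v * v + v * v) + k * k * k"
  proof -
    have uu: "u * u + u * u = (1 / 2) *\<^sub>R ((d + star d) * (d + star d))"
      by (simp add: u_def scaleR_add_left[symmetric])
    have vv: "v * v + v * v = (- 1 / 2) *\<^sub>R ((d - star d) * (d - star d))"
    proof -
      have "v * v = (- 1 / 4) *\<^sub>R ((d - star d) * (d - star d))"
        by (simp add: v_def scaleR_scaleC)
      then have "v * v + v * v = (- 1 / 4 + - 1 / 4) *\<^sub>R ((d - star d) * (d - star d))"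
        by (simp only: scaleR_add_left)
      then show ?thesis by simp
    qed
    have "(d + star d) * (d + star d) - (d - star d) * (d - star d) = 2 *\<^sub>R (d * star d + star d * d)"
      by (simp add: algebra_simps scaleR_2)
    then have "(u * u + u * u) + (v * v + v * v) = d * star d + star d * d"
      unfolding uu vv by (simp add: scaleR_diff_right[symmetric])
    then show ?thesis by (simp add: dd)
  qed
  then have pdd: "pos (d * star d)"
    using pos_square[OF su] pos_square[OF sv] k3 by (simp add: pos_add)
  have "pos (star d * d)"
  proof (rule posI)
    show "star (star d * d) = star d * d" by (simp add: star_mult star_star)
    fix z assume z: "z \<in> spec (star d * d)"
    show "Re z \<ge> 0"
    proof (cases "z = 0")
      case False
      then show ?thesis using pos_spec(2)[OF pdd spec_mult_swap[OF z]] by simp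
    qed simp
  qed
  moreover have "pos (of_real 0 - star d * d)" using k3 by (simp add: dd)
  ultimately have "norm (star d * d) \<le> 0" by (rule norm_le_of_pos) simp
  then have "k * k * k = 0" by (simp add: dd)
  then have "norm ((k * k) * (k * k)) = 0" by (metis mult.assoc mult_zero_right norm_zero)
  then have "norm k = 0"
    using norm_square_self_adjoint[of "k * k"] norm_square_self_adjoint[of k] sk
    by (simp add: star_mult)
  then have "x = pos_part t x" using pn(3) by (simp add: k_def)
  then show ?thesis using pn(1) by (simp add: x_def)
qed

text \<open>With \<open>x = q\<^sup>2\<close> the conjugate is \<open>(q b)\<^sup>* (q b)\<close>.\<close>

lemma pos_conjugate:
  assumes "pos x" shows "pos (star b * x * b)"
proof -
  obtain q where q: "pos q" "q * q = x" using pos_sqrt[OF assms] by blast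
  have "star b * x * b = star (q * b) * (q * b)"
    using q by (simp add: star_mult pos_star mult.assoc[symmetric]) (simp add: mult.assoc)
  then show ?thesis by (simp add: pos_star_mult)
qed

lemma pos_shift_has_inverse:
  assumes "pos x" shows "has_inverse (1 + x)"
proof -
  have "- 1 \<notin> spec x" using pos_spec(2)[OF assms] by force
  then have "has_inverse (- ((- 1) *\<^sub>C 1 - x))" unfolding has_inverse_minus spec_def by simp
  then show ?thesis by (simp add: add.commute)
qed

section \<open>Similarity to an element of norm at most the quotient norm\<close>

text \<open>For \<open>k = x x\<^sup>*\<close>, which is in \<open>I\<close>, the element \<open>u = m k (1 + m k)\<^sup>-\<^sup>1\<close> of \<open>I\<close> is an approximate unit for \<open>x\<^sup>*\<close>:
with \<open>w = 1 - u\<close>, which satisfies \<open>0 \<le> w \<le> 1\<close>, one has \<open>\<parallel>x\<^sup>* - x\<^sup>* u\<parallel>\<^sup>2 = \<parallel>w k w\<parallel> = \<parallel>w (1 - w)\<parallel> / m\<close>, which tends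
to \<open>0\<close>. Hence \<open>x\<^sup>*\<close> is a limit of elements \<open>x\<^sup>* u\<close> of \<open>I\<close>.\<close>

lemma ideal_star:
  fixes x :: "'a::unital_cstar_algebra"
  assumes I: "closed_two_sided_ideal I" and x: "x \<in> I"
  shows "star x \<in> I"
proof -
  define k where "k = x * star x"
  have k: "pos k" using pos_star_mult[of "star x"] by (simp add: k_def star_star)
  have kI: "k \<in> I" using ideal_mult_right[OF I x] by (simp add: k_def)
  have "\<exists>y\<in>I. norm (y - star x) \<le> sqrt (2 / real (Suc m))" for m
  proof -
    define l where "l = real (Suc m) *\<^sub>R k"
    have l: "pos l"
    proof -
      have "l = star (of_real (sqrt (real (Suc m)))) * k * of_real (sqrt (real (Suc m)))"
        by (simp add: l_def of_real_def star_scaleR)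
      then show ?thesis using pos_conjugate[OF k] by metis
    qed
    define w where "w = inv_el (1 + l)"
    have w: "(1 + l) * w = 1" "w * (1 + l) = 1"
      using inv_el[OF pos_shift_has_inverse[OF l]] by (simp_all add: w_def)
    have sw: "star w = w"
    proof -
      have "star ((1 + l) * w) = 1" "star (w * (1 + l)) = 1" by (simp_all add: w)
      then have "star w * (1 + l) = 1" "(1 + l) * star w = 1"
        by (simp_all add: star_mult star_add pos_star[OF l])
      then show ?thesis using inv_el_unique[of "1 + l" "star w"] by (simp add: w_def)
    qed
    have lw: "l * w = 1 - w" "w * l = 1 - w"
      using w by (simp_all add: algebra_simps)
    have "norm w \<le> 1"
    proof (rule norm_le_of_pos)
      have "w = star w * (1 + l) * w" by (simp add: sw w)
      then show "pos w" using pos_conjugate[OF pos_add[OF pos_one l]] by metis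
      have "star w * (l + star l * l) * w = w * (l * ((1 + l) * w))"
        by (simp add: sw pos_star[OF l] algebra_simps)
      then have "star w * (l + star l * l) * w = of_real 1 - w" by (simp add: w lw)
      then show "pos (of_real 1 - w)"
        using pos_conjugate[OF pos_add[OF l pos_star_mult[of l]]] by metis
    qed simp
    then have "norm (w * (1 - w)) \<le> 1 * (1 + 1)"
      by (intro order_trans[OF norm_mult_ineq] mult_mono order_trans[OF norm_triangle_ineq4]) simp_all
    moreover have "w * (1 - w) = real (Suc m) *\<^sub>R (w * k * w)"
      unfolding lw(1)[symmetric] by (simp add: l_def mult.assoc)
    ultimately have "real (Suc m) * norm (w * k * w) \<le> 2" by simp
    then have wkw: "norm (w * k * w) \<le> 2 / real (Suc m)"
      by (simp add: pos_le_divide_eq mult.commute)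
    have "(norm (star x * w))\<^sup>2 = norm (star (star x * w) * (star x * w))"
      by (simp add: cstar_identity)
    also have "star (star x * w) * (star x * w) = w * k * w"
      by (simp add: star_mult star_star sw k_def mult.assoc)
    finally have "norm (star x * w) \<le> sqrt (2 / real (Suc m))"
      using wkw by (simp add: real_le_rsqrt)
    moreover have "star x * (l * w) \<in> I"
      unfolding l_def by (intro ideal_mult_left[OF I] ideal_mult_right[OF I] ideal_scaleR[OF I] kI)
    moreover have "norm (star x * (l * w) - star x) = norm (star x * w)"
      by (simp add: lw right_diff_distrib)
    ultimately show ?thesis by (intro bexI[of _ "star x * (l * w)"]) simp_all
  qed
  note approx = this
  have lim: "(\<lambda>m. sqrt (2 / real (Suc m))) \<longlonglongrightarrow> 0"
    using tendsto_real_sqrt[OF LIMSEQ_Suc[OF lim_const_over_n[of "2::real"]]] by simp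
  have "\<exists>y\<in>I. dist y (star x) < \<epsilon>" if "\<epsilon> > 0" for \<epsilon>
  proof -
    have "eventually (\<lambda>m. sqrt (2 / real (Suc m)) < \<epsilon>) sequentially"
      by (rule order_tendstoD(2)[OF lim that])
    then obtain m where m: "sqrt (2 / real (Suc m)) < \<epsilon>"
      by (rule eventually_happens'[OF sequentially_bot, THEN exE])
    obtain y where "y \<in> I" "norm (y - star x) \<le> sqrt (2 / real (Suc m))"
      using approx[of m] by (rule bexE)
    then show ?thesis using m unfolding dist_norm by (intro bexI[of _ y]) linarith+
  qed
  then have "star x \<in> closure I" by (simp add: closure_approachable)
  then show ?thesis using ideal_closed[OF I] by (simp add: closure_closed)
qed

text \<open>Choose \<open>b\<close> in \<open>a + I\<close> with norm at most slightly above \<open>1\<close>. Then \<open>b\<^sup>* b - 1\<close> is congruent to \<open>a\<^sup>* a - 1\<close>, so the positive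
parts are congruent as well, and the positive part of \<open>b\<^sup>* b - 1\<close> is small. Hence the positive part of
\<open>a\<^sup>* a - 1\<close> is a limit of elements of \<open>I\<close>.\<close>

lemma excess_in_ideal:
  fixes a :: "'a::unital_cstar_algebra"
  assumes I: "closed_two_sided_ideal I"
    and dist: "\<And>\<epsilon>. \<epsilon> > 0 \<Longrightarrow> \<exists>i\<in>I. norm (a + i) < 1 + \<epsilon>"
  shows "\<exists>p n. p \<in> I \<and> pos p \<and> pos n \<and> p - n = star a * a - 1"
proof -
  define y where "y = star a * a - 1"
  \<comment> \<open>The number \<open>25\<close> bounds \<open>\<parallel>b\<^sup>* b - 1\<parallel>\<^sup>2\<close> for every \<open>b\<close> of norm at most \<open>2\<close>.\<close>
  define T where "T = max 25 ((norm y)\<^sup>2)"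
  have sa: "star (star b * b - 1) = star b * b - 1" for b :: 'a
    by (simp add: star_diff star_mult star_star)
  have T: "T > 0" "T \<ge> (norm y)\<^sup>2" by (simp_all add: T_def)
  have "\<exists>z\<in>I. dist z (pos_part T y) < \<epsilon>" if \<epsilon>: "\<epsilon> > 0" for \<epsilon>
  proof -
    define \<delta> where "\<delta> = min 1 (\<epsilon> / 4)"
    have \<delta>: "0 < \<delta>" "\<delta> \<le> 1" "4 * \<delta> \<le> \<epsilon>" using \<epsilon> by (simp_all add: \<delta>_def)
    obtain i where i: "i \<in> I" "norm (a + i) < 1 + \<delta>" using dist[OF \<delta>(1)] by blast
    define b where "b = a + i"
    define w where "w = star b * b - 1"
    have nb: "norm (star b * b) \<le> 1 + 3 * \<delta>"
    proof -
      have "norm (star b * b) \<le> (1 + \<delta>)\<^sup>2"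
        using i(2) by (simp add: cstar_identity b_def power_mono)
      also have "\<dots> = 1 + 2 * \<delta> + \<delta> * \<delta>" by (simp add: power2_eq_square algebra_simps)
      also have "\<delta> * \<delta> \<le> \<delta>" using \<delta> mult_left_le[of \<delta> \<delta>] by simp
      finally show ?thesis by simp
    qed
    have Tw: "T \<ge> (norm w)\<^sup>2"
    proof -
      have "norm w \<le> 5"
        using norm_triangle_ineq4[of "star b * b" 1] nb \<delta>(2) by (simp add: w_def)
      then have "(norm w)\<^sup>2 \<le> 5\<^sup>2" by (intro power_mono) simp_all
      then show ?thesis by (simp add: T_def)
    qed
    have yw: "y - w \<in> I"
    proof -
      have "star a - star b \<in> I" "a - b \<in> I"
        using ideal_minus[OF I ideal_star[OF I i(1)]] ideal_minus[OF I i(1)]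
        by (simp_all add: b_def star_add)
      from ideal_mult_cong[OF I this] show ?thesis by (simp add: y_def w_def)
    qed
    have "pos (of_real (norm (star b * b)) - star b * b)"
    proof (rule posI)
      show "star (of_real (norm (star b * b)) - star b * b) = of_real (norm (star b * b)) - star b * b"
        by (simp add: star_diff star_mult star_star)
      fix c assume "c \<in> spec (of_real (norm (star b * b)) - star b * b)"
      then have "of_real (norm (star b * b)) - c \<in> spec (star b * b)"
        by (simp add: spec_of_real_diff)
      from spec_norm_le[OF this] show "0 \<le> Re c"
        using complex_Re_le_cmod[of "of_real (norm (star b * b)) - c"] by simp
    qed
    moreover have "pos (of_real r :: 'a)" if "r \<ge> 0" for r
      using that unfolding pos_def by (intro conjI exI[of _ r]) simp_all
    moreover have "0 \<le> 1 + 3 * \<delta> - norm (star b * b)" using nb by simp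
    ultimately have "pos (of_real (1 + 3 * \<delta> - norm (star b * b)) + (of_real (norm (star b * b)) - star b * b))"
      by (intro pos_add)
    then have "pos (of_real (3 * \<delta>) - w)" by (simp add: w_def algebra_simps)
    then have "norm (pos_part T w) \<le> 3 * \<delta>"
      using \<delta> Tw T by (intro pos_part_norm) (simp_all add: w_def sa)
    then have "norm (pos_part T w) < \<epsilon>" using \<delta> by simp
    moreover have "pos_part T y - pos_part T w \<in> I"
      using I yw T Tw by (intro pos_part_cong) (simp_all add: y_def w_def sa)
    ultimately show ?thesis
      by (intro bexI[of _ "pos_part T y - pos_part T w"]) (simp_all add: dist_norm)
  qed
  then have "pos_part T y \<in> closure I" by (simp add: closure_approachable)
  then have "pos_part T y \<in> I" using ideal_closed[OF I] by (simp add: closure_closed)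
  then show ?thesis
    using pos_neg_part[OF sa[of a, folded y_def] T] unfolding y_def by blast
qed

text \<open>In the notation of the introduction, \<open>g = h - 1\<close> and \<open>q\<close> is the square root of \<open>h\<close>. The inequality
\<open>a\<^sup>* h a \<le> h\<close> becomes \<open>(q a q\<^sup>-\<^sup>1)\<^sup>* (q a q\<^sup>-\<^sup>1) \<le> 1\<close> after conjugation with \<open>q\<^sup>-\<^sup>1\<close>.\<close>

lemma contractive_similarity:
  fixes a :: "'a::unital_cstar_algebra"
  assumes I: "closed_two_sided_ideal I"
    and dist: "\<And>\<epsilon>. \<epsilon> > 0 \<Longrightarrow> \<exists>i\<in>I. norm (a + i) < 1 + \<epsilon>"
    and s: "0 < s" "s < 1" and spec: "\<And>c. s \<le> cmod c \<Longrightarrow> c \<notin> spec a"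
  shows "\<exists>e\<in>I. has_inverse (1 + e) \<and> norm ((1 + e) * a * inv_el (1 + e)) \<le> 1"
proof -
  obtain p n where pI: "p \<in> I" and p: "pos p" and n: "pos n" and pn: "p - n = star a * a - 1"
    using excess_in_ideal[OF I dist] by blast
  obtain C where C: "\<And>k. norm (a ^ k) \<le> C * s ^ k"
    using power_bound[OF s(1) spec] by blast
  define f where "f k = star (a ^ k) * p * a ^ k" for k
  have fS: "f (Suc k) = star a * f k * a" for k
    unfolding f_def power_Suc2 by (simp add: star_mult mult.assoc)
  have sum: "summable f"
  proof (rule summable_comparison_test')
    show "summable (\<lambda>k. (C * norm p * C) * (s * s) ^ k)"
      using s by (intro summable_mult summable_geometric) (simp add: abs_mult mult_strict_mono[of s 1 s 1, simplified])
    fix k :: nat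
    have C0: "0 \<le> C" using order_trans[OF norm_ge_zero C[of 0]] by simp
    have "norm (f k) \<le> norm (star (a ^ k)) * norm p * norm (a ^ k)"
      unfolding f_def by (intro order_trans[OF norm_mult_ineq] mult_right_mono norm_mult_ineq) simp_all
    also have "\<dots> \<le> (C * s ^ k) * norm p * (C * s ^ k)"
      using C[of k] C0 s by (intro mult_mono) (simp_all add: norm_star)
    finally show "norm (f k) \<le> (C * norm p * C) * (s * s) ^ k"
      by (simp add: power_mult_distrib mult_ac)
  qed
  define g where "g = (\<Sum>k. f k)"
  have lim: "(\<lambda>m. \<Sum>k<m. f k) \<longlonglongrightarrow> g"
    using sum by (simp add: g_def summable_LIMSEQ)
  have gI: "g \<in> I"
  proof (rule closed_sequentially[OF ideal_closed[OF I] _ lim])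
    show "(\<Sum>k<m. f k) \<in> I" for m
      by (induction m) (simp_all add: f_def ideal_zero[OF I] ideal_add[OF I]
        ideal_mult_left[OF I] ideal_mult_right[OF I] pI)
  qed
  have g: "pos g"
  proof (rule pos_limit[OF _ lim])
    have "pos (0::'a)" using pos_square[of "0::'a"] by simp
    then show "pos (\<Sum>k<m. f k)" for m
      by (induction m) (simp_all add: f_def pos_add pos_conjugate p)
  qed
  have aga: "star a * g * a = g - p"
  proof -
    have "g = f 0 + (\<Sum>k. f (Suc k))"
      unfolding g_def using suminf_split_head[OF sum] by simp
    also have "(\<Sum>k. f (Suc k)) = star a * g * a"
      unfolding fS g_def suminf_mult[OF sum, symmetric] suminf_mult2[OF summable_mult[OF sum]] ..
    finally have "g = f 0 + star a * g * a" .
    moreover have "f 0 = p" by (simp add: f_def)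
    ultimately show ?thesis by (metis add_diff_cancel_left')
  qed
  define h where "h = 1 + g"
  have h: "pos h" "has_inverse h"
    unfolding h_def by (intro pos_add pos_one g, intro pos_shift_has_inverse g)
  have aha: "star a * h * a = h - n"
  proof -
    have "star a * h * a = star a * a + star a * g * a"
      by (simp add: h_def distrib_left distrib_right)
    also have "star a * a = 1 + (p - n)" using pn by simp
    finally show ?thesis by (simp add: aga h_def)
  qed
  obtain q where q: "pos q" "q * q = h" using pos_sqrt[OF h(1)] by blast
  have iq: "has_inverse q" by (rule has_inverse_factor[of q q]) (simp_all add: q h)
  define v where "v = inv_el q"
  have v: "q * v = 1" "v * q = 1" using inv_el[OF iq] by (simp_all add: v_def)
  have sv: "star v = v"
  proof -
    have "star (q * v) = 1" "star (v * q) = 1" by (simp_all add: v)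
    then show ?thesis using inv_el_unique[of q "star v"] by (simp add: star_mult pos_star[OF q(1)] v_def)
  qed
  have eI: "q - 1 \<in> I"
  proof -
    have iq1: "has_inverse (1 + q)" by (rule pos_shift_has_inverse[OF q(1)])
    have "(1 + q) * (q - 1) = g" using q(2) by (simp add: h_def algebra_simps)
    then have "q - 1 = inv_el (1 + q) * g"
      using inv_el(2)[OF iq1] by (metis mult.assoc mult_1_left)
    then show ?thesis using ideal_mult_left[OF I gI] by simp
  qed
  have "norm (q * a * v) \<le> 1"
  proof -
    have "star (q * a * v) * (q * a * v) = v * (star a * h * a) * v"
      by (simp add: star_mult sv pos_star[OF q(1)] q(2)[symmetric] mult.assoc)
    also have "\<dots> = v * (q * q) * v - v * n * v"
      by (simp add: aha q(2) left_diff_distrib right_diff_distrib)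
    also have "v * (q * q) * v = 1"
      using v by (metis mult.assoc mult_1_left)
    finally have e: "star (q * a * v) * (q * a * v) = 1 - v * n * v" .
    have "norm (star (q * a * v) * (q * a * v)) \<le> 1"
    proof (rule norm_le_of_pos[OF pos_star_mult])
      show "pos (of_real 1 - star (q * a * v) * (q * a * v))"
        unfolding e using pos_conjugate[OF n, of v] by (simp add: sv)
    qed simp
    then have "(norm (q * a * v))\<^sup>2 \<le> 1\<^sup>2" by (simp add: cstar_identity)
    then show ?thesis by (rule power2_le_imp_le) simp
  qed
  then show ?thesis
    using eI iq by (intro bexI[of _ "q - 1"]) (simp_all add: v_def)
qed

theorem similarity_norm_le:
  fixes a :: "'a::unital_cstar_algebra"
  assumes I: "closed_two_sided_ideal I"
    and dist: "\<And>\<epsilon>. \<epsilon> > 0 \<Longrightarrow> \<exists>i\<in>I. norm (a + i) < t + \<epsilon>"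
    and s: "0 < s" "s < t" and spec: "\<And>c. s \<le> cmod c \<Longrightarrow> c \<notin> spec a"
  shows "\<exists>e\<in>I. has_inverse (1 + e) \<and> norm ((1 + e) * a * inv_el (1 + e)) \<le> t"
proof -
  have t: "t > 0" using s by simp
  define b where "b = (1 / t) *\<^sub>R a"
  have ab: "a = t *\<^sub>R b" using t by (simp add: b_def)
  have "\<exists>e\<in>I. has_inverse (1 + e) \<and> norm ((1 + e) * b * inv_el (1 + e)) \<le> 1"
  proof (rule contractive_similarity[OF I])
    fix \<epsilon> :: real assume "\<epsilon> > 0"
    then obtain i where i: "i \<in> I" "norm (a + i) < t + t * \<epsilon>" using dist[of "t * \<epsilon>"] t by auto
    have "norm (b + (1 / t) *\<^sub>R i) = norm (a + i) / t"
      using t by (simp add: b_def scaleR_add_right[symmetric])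
    also have "\<dots> < 1 + \<epsilon>" using i t by (simp add: pos_divide_less_eq algebra_simps)
    finally show "\<exists>i\<in>I. norm (b + i) < 1 + \<epsilon>" using ideal_scaleR[OF I i(1)] by blast
  next
    show "0 < s / t" "s / t < 1" using s by simp_all
    fix c assume c: "s / t \<le> cmod c"
    have "c * of_real t \<notin> spec a"
      using c t by (intro spec) (simp add: norm_mult pos_divide_le_eq)
    then show "c \<notin> spec b"
      using t spec_scaleC[of "of_real (1 / t)" c a] by (simp add: b_def scaleR_scaleC)
  qed
  then obtain e where e: "e \<in> I" "has_inverse (1 + e)" "norm ((1 + e) * b * inv_el (1 + e)) \<le> 1"
    by blast
  have "norm ((1 + e) * a * inv_el (1 + e)) = t * norm ((1 + e) * b * inv_el (1 + e))"
    using t by (simp add: ab)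
  then show ?thesis using e t mult_left_le[of _ t] by (metis less_imp_le)
qed

section \<open>The unitization as a unital C*-algebra\<close>

text \<open>A type of its own makes the unital theory applicable to \<open>A \<times> \<complex>\<close>. If \<open>A\<close> has a unit then left
multiplication by \<open>(-1, 1)\<close> is zero on \<open>A\<close>, so the operator norm alone would not be definite; the
maximum with the modulus of the scalar part is the \<open>C\<^sup>*\<close>-norm in either case.\<close>

datatype 'a unitization = Unitize (base: 'a) (scal: complex)

definition act :: "'a::cstar_algebra unitization \<Rightarrow> 'a \<Rightarrow> 'a" where
  "act z y = base z * y + scal z *\<^sub>C y"

lemma bounded_linear_scaleC: "bounded_linear (\<lambda>y. c *\<^sub>C (y::'a::cstar_algebra))"
proof (rule bounded_linear_intro[where K = "cmod c"])
  show "c *\<^sub>C (r *\<^sub>R x) = r *\<^sub>R (c *\<^sub>C x)" for r and x :: 'a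
    by (simp add: scaleR_scaleC mult.commute)
qed (simp_all add: scaleC_add_right norm_scaleC mult.commute)

lemma bounded_linear_act: "bounded_linear (act z)"
  unfolding act_def[abs_def]
  by (intro bounded_linear_add bounded_linear_scaleC bounded_linear_mult_right)

lemma norm_act_le: "norm (act z y) \<le> onorm (act z) * norm y"
  by (rule onorm[OF bounded_linear_act])

lemma onorm_act_embed: "onorm (act (Unitize x 0)) = norm x"
  using plus_norm_embed[of x] by (simp add: plus_norm_def plus_embed_def act_def[abs_def])

instantiation unitization :: (cstar_algebra) real_normed_algebra_1
begin

definition zero_unitization where "0 = Unitize 0 0"
definition one_unitization where "1 = Unitize 0 1"
definition plus_unitization where "z + w = Unitize (base z + base w) (scal z + scal w)"
definition minus_unitization where "z - w = Unitize (base z - base w) (scal z - scal w)"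
definition uminus_unitization where "- z = Unitize (- base z) (- scal z)"
definition scaleR_unitization where "r *\<^sub>R z = Unitize (r *\<^sub>R base z) (r *\<^sub>R scal z)"
definition times_unitization where
  "z * w = Unitize (base z * base w + scal z *\<^sub>C base w + scal w *\<^sub>C base z) (scal z * scal w)"
definition norm_unitization where
  "norm z = max (onorm (act z)) (cmod (scal z))"
definition sgn_unitization where "sgn (z::'a unitization) = inverse (norm z) *\<^sub>R z"
definition dist_unitization where "dist (z::'a unitization) w = norm (z - w)"
definition uniformity_unitization :: "('a unitization \<times> 'a unitization) filter" where
  "uniformity_unitization = (INF e\<in>{0<..}. principal {(z, w). dist z w < e})"
definition open_unitization :: "'a unitization set \<Rightarrow> bool" where
  "open_unitization U \<longleftrightarrow> (\<forall>z\<in>U. eventually (\<lambda>(z', w). z' = z \<longrightarrow> w \<in> U) uniformity)"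

lemmas unitization_ops = zero_unitization_def one_unitization_def plus_unitization_def
  minus_unitization_def uminus_unitization_def scaleR_unitization_def times_unitization_def

instance
proof
  fix z w v :: "'a unitization" and r s :: real
  have act_add: "act (z + w) = (\<lambda>y. act z y + act w y)" for z w :: "'a unitization"
    by (auto simp: act_def unitization_ops scaleC_add_left algebra_simps)
  have act_mult: "act (z * w) = act z \<circ> act w" for z w :: "'a unitization"
    by (auto simp: act_def unitization_ops scaleC_add_right algebra_simps)
  have act_scaleR: "act (r *\<^sub>R z) = (\<lambda>y. r *\<^sub>R act z y)" for r and z :: "'a unitization"
    by (auto simp: fun_eq_iff act_def unitization_ops scaleC_add_right scaleR_scaleC scaleR_conv_of_real)
  show "z + w + v = z + (w + v)" "z + w = w + z" "0 + z = z" "- z + z = 0" "z - w = z + - w"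
    "r *\<^sub>R (z + w) = r *\<^sub>R z + r *\<^sub>R w" "(r + s) *\<^sub>R z = r *\<^sub>R z + s *\<^sub>R z"
    "r *\<^sub>R s *\<^sub>R z = (r * s) *\<^sub>R z" "1 *\<^sub>R z = z"
    by (simp_all add: unitization_ops algebra_simps)
  show "z * w * v = z * (w * v)"
    by (simp add: unitization_ops algebra_simps scaleC_add_right)
  show "(z + w) * v = z * v + w * v" "z * (w + v) = z * w + z * v"
    by (simp_all add: unitization_ops algebra_simps scaleC_add_right scaleC_add_left)
  show "r *\<^sub>R z * w = r *\<^sub>R (z * w)" "z * r *\<^sub>R w = r *\<^sub>R (z * w)"
    by (simp_all add: unitization_ops scaleC_add_right scaleR_scaleC scaleR_conv_of_real mult_ac)
  show "1 * z = z" "z * 1 = z" "(0::'a unitization) \<noteq> 1"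
    by (simp_all add: unitization_ops)
  show "dist z w = norm (z - w)" "sgn z = inverse (norm z) *\<^sub>R z"
    by (simp_all only: dist_unitization_def sgn_unitization_def)
  show "uniformity = (INF e\<in>{0<..}. principal {(z, w :: 'a unitization). dist z w < e})"
    by (rule uniformity_unitization_def)
  show "open U \<longleftrightarrow> (\<forall>z\<in>U. eventually (\<lambda>(z', w). z' = z \<longrightarrow> w \<in> U) uniformity)"
    for U :: "'a unitization set"
    by (rule open_unitization_def)
  show "norm z = 0 \<longleftrightarrow> z = 0"
  proof
    assume n: "norm z = 0"
    then have "scal z = 0" by (metis norm_unitization_def max.cobounded2 norm_le_zero_iff)
    then have z: "z = Unitize (base z) 0" by (metis unitization.collapse)
    have "onorm (act z) \<le> 0" using n by (simp add: norm_unitization_def)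
    then have "base z = 0" using onorm_act_embed[of "base z"] z by simp
    then show "z = 0" using z by (simp add: zero_unitization_def)
  next
    assume "z = 0"
    then show "norm z = 0" using onorm_act_embed[of "0::'a"]
      by (simp add: norm_unitization_def zero_unitization_def)
  qed
  show "norm (z + w) \<le> norm z + norm w"
  proof -
    have "onorm (act (z + w)) \<le> onorm (act z) + onorm (act w)"
      unfolding act_add by (intro onorm_triangle bounded_linear_act)
    moreover have "cmod (scal (z + w)) \<le> cmod (scal z) + cmod (scal w)"
      by (simp add: plus_unitization_def norm_triangle_ineq)
    ultimately show ?thesis unfolding norm_unitization_def by linarith
  qed
  show "norm (r *\<^sub>R z) = \<bar>r\<bar> * norm z"
  proof -
    have "onorm (act (r *\<^sub>R z)) = \<bar>r\<bar> * onorm (act z)"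
      unfolding act_scaleR by (intro onorm_scaleR bounded_linear_act)
    moreover have "cmod (scal (r *\<^sub>R z)) = \<bar>r\<bar> * cmod (scal z)"
      by (simp add: scaleR_unitization_def)
    ultimately show ?thesis by (simp add: norm_unitization_def max_mult_distrib_left)
  qed
  show "norm (z * w) \<le> norm z * norm w"
  proof -
    have "onorm (act (z * w)) \<le> onorm (act z) * onorm (act w)"
      unfolding act_mult by (intro onorm_compose bounded_linear_act)
    also have "\<dots> \<le> norm z * norm w"
      by (intro mult_mono) (simp_all add: norm_unitization_def onorm_pos_le bounded_linear_act le_max_iff_disj)
    finally have "onorm (act (z * w)) \<le> norm z * norm w" .
    moreover have "cmod (scal (z * w)) \<le> norm z * norm w"
      unfolding times_unitization_def unitization.sel norm_mult
      by (intro mult_mono) (simp_all add: norm_unitization_def le_max_iff_disj)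
    ultimately show ?thesis by (simp add: norm_unitization_def[of "z * w"])
  qed
  show "norm (1 :: 'a unitization) = 1"
  proof -
    have "act (1 :: 'a unitization) = (\<lambda>y. y)" by (auto simp: act_def one_unitization_def)
    then have "onorm (act (1 :: 'a unitization)) \<le> 1"
      using onorm_id_le by (simp add: id_def)
    then show ?thesis by (simp add: norm_unitization_def one_unitization_def)
  qed
qed

end

lemma norm_base_le: "norm (base z) \<le> 2 * norm (z::'a::cstar_algebra unitization)"
proof -
  have e: "act (Unitize (base z) 0) = (\<lambda>y. act z y + (- scal z) *\<^sub>C y)"
    by (auto simp: act_def)
  have "norm (base z) = onorm (\<lambda>y. act z y + (- scal z) *\<^sub>C y)"
    unfolding onorm_act_embed[symmetric] e ..
  also have "\<dots> \<le> onorm (act z) + onorm (\<lambda>y::'a. (- scal z) *\<^sub>C y)"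
    by (intro onorm_triangle bounded_linear_act bounded_linear_scaleC)
  also have "onorm (\<lambda>y::'a. (- scal z) *\<^sub>C y) \<le> cmod (scal z)"
    by (rule onorm_bound) (simp_all add: norm_scaleC)
  finally show ?thesis by (simp add: norm_unitization_def)
qed

lemma cmod_scal_le: "cmod (scal z) \<le> norm (z::'a::cstar_algebra unitization)"
  by (simp add: norm_unitization_def)

lemma norm_unitization_le: "norm z \<le> norm (base z) + cmod (scal (z::'a::cstar_algebra unitization))"
proof -
  have "norm (act z y) \<le> (norm (base z) + cmod (scal z)) * norm y" for y
    using norm_triangle_ineq[of "base z * y" "scal z *\<^sub>C y"] norm_mult_ineq[of "base z" y]
    by (simp add: act_def norm_scaleC algebra_simps)
  then have "onorm (act z) \<le> norm (base z) + cmod (scal z)"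
    by (intro onorm_bound) simp_all
  then show ?thesis by (simp add: norm_unitization_def)
qed

lemma bounded_linear_base: "bounded_linear (base :: 'a::cstar_algebra unitization \<Rightarrow> 'a)"
  by (rule bounded_linear_intro[where K = 2])
     (simp_all add: unitization_ops norm_base_le mult.commute[of _ "2::real"])

lemma bounded_linear_scal: "bounded_linear (scal :: 'a::cstar_algebra unitization \<Rightarrow> complex)"
  by (rule bounded_linear_intro[where K = 1]) (simp_all add: unitization_ops cmod_scal_le)

instance unitization :: (cstar_algebra) banach
proof
  fix X :: "nat \<Rightarrow> 'a unitization"
  assume X: "Cauchy X"
  have "Cauchy (\<lambda>n. base (X n))"
    by (rule bounded_linear.Cauchy[OF bounded_linear_base X])
  then obtain l where l: "(\<lambda>n. base (X n)) \<longlonglongrightarrow> l"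
    using Cauchy_convergent convergentD by blast
  have "Cauchy (\<lambda>n. scal (X n))"
    by (rule bounded_linear.Cauchy[OF bounded_linear_scal X])
  then obtain m where m: "(\<lambda>n. scal (X n)) \<longlonglongrightarrow> m"
    using Cauchy_convergent convergentD by blast
  have "(\<lambda>n. norm (base (X n) - l) + cmod (scal (X n) - m)) \<longlonglongrightarrow> 0"
    using tendsto_add[OF tendsto_norm[OF l[THEN LIM_zero]] tendsto_norm[OF m[THEN LIM_zero]]] by simp
  then have "(\<lambda>n. X n - Unitize l m) \<longlonglongrightarrow> 0"
  proof (rule Lim_null_comparison[rotated])
    show "\<forall>\<^sub>F n in sequentially. norm (X n - Unitize l m) \<le> norm (base (X n) - l) + cmod (scal (X n) - m)"
      using norm_unitization_le[of "X _ - Unitize l m"] by (simp add: minus_unitization_def)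
  qed
  then have "X \<longlonglongrightarrow> Unitize l m" by (simp only: LIM_zero_iff)
  then show "convergent X" by (rule convergentI)
qed

instantiation unitization :: (cstar_algebra) unital_cstar_algebra
begin

definition scaleC_unitization where "c *\<^sub>C z = Unitize (c *\<^sub>C base z) (c * scal z)"
definition star_unitization where "star z = Unitize (star (base z)) (cnj (scal z))"

instance
proof
  fix z w v :: "'a unitization" and r s :: real and c d :: complex
  show "r *\<^sub>R z = complex_of_real r *\<^sub>C z"
    by (simp add: scaleC_unitization_def scaleR_unitization_def scaleR_scaleC scaleR_conv_of_real)
  show "c *\<^sub>C (z + w) = c *\<^sub>C z + c *\<^sub>C w" "(c + d) *\<^sub>C z = c *\<^sub>C z + d *\<^sub>C z"
    "c *\<^sub>C (d *\<^sub>C z) = (c * d) *\<^sub>C z" "1 *\<^sub>C z = z"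
    "(c *\<^sub>C z) * w = c *\<^sub>C (z * w)" "z * (c *\<^sub>C w) = c *\<^sub>C (z * w)"
    by (simp_all add: scaleC_unitization_def unitization_ops scaleC_add_left scaleC_add_right
        distrib_left distrib_right mult_ac)
  show "norm (c *\<^sub>C z) = cmod c * norm z"
  proof -
    have le: "norm (c *\<^sub>C z) \<le> cmod c * norm z" for c and z :: "'a unitization"
    proof -
      have "norm (act (c *\<^sub>C z) y) \<le> cmod c * onorm (act z) * norm y" for y
      proof -
        have "act (c *\<^sub>C z) y = c *\<^sub>C act z y"
          by (simp add: act_def scaleC_unitization_def scaleC_add_right)
        then show ?thesis
          using mult_left_mono[OF norm_act_le[of z y], of "cmod c"] by (simp add: norm_scaleC mult_ac)
      qed
      then have "onorm (act (c *\<^sub>C z)) \<le> cmod c * onorm (act z)"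
        by (intro onorm_bound) (simp_all add: onorm_pos_le bounded_linear_act)
      moreover have "cmod (scal (c *\<^sub>C z)) = cmod c * cmod (scal z)"
        by (simp add: scaleC_unitization_def norm_mult)
      ultimately show ?thesis
        unfolding norm_unitization_def by (simp add: max_mult_distrib_left max.coboundedI1 max.coboundedI2)
    qed
    show ?thesis
    proof (cases "c = 0")
      case True
      then show ?thesis using le[of c z] by simp
    next
      case False
      have "inverse c *\<^sub>C (c *\<^sub>C z) = z"
        using False by (cases z) (simp add: scaleC_unitization_def)
      then have "norm z \<le> cmod (inverse c) * norm (c *\<^sub>C z)" using le by metis
      then have "cmod c * norm z \<le> norm (c *\<^sub>C z)"
        using False by (simp add: norm_inverse norm_divide field_simps)
      then show ?thesis using le[of c z] by simp
    qed
  qed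
  show "star (z + w) = star z + star w" "star (c *\<^sub>C z) = cnj c *\<^sub>C star z"
    by (simp_all add: star_unitization_def scaleC_unitization_def plus_unitization_def star_add star_scaleC)
  show "star (z * w) = star w * star z"
    by (simp add: star_unitization_def times_unitization_def star_add star_scaleC star_mult)
  show star2: "star (star z) = z" for z :: "'a unitization"
    by (simp add: star_unitization_def star_star)
  have le: "(norm z)\<^sup>2 \<le> norm (star z * z)" for z :: "'a unitization"
  proof -
    let ?N = "onorm (act (star z * z))"
    have N0: "?N \<ge> 0" by (intro onorm_pos_le bounded_linear_act)
    have "norm (act z y) \<le> sqrt ?N * norm y" for y
    proof -
      have e: "star (act z y) * act z y = star y * act (star z * z) y"
        by (simp add: act_def star_unitization_def times_unitization_def star_add star_mult star_scaleC
            algebra_simps scaleC_add_right)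
      have "(norm (act z y))\<^sup>2 = norm (star y * act (star z * z) y)"
        by (simp only: cstar_identity[symmetric] e)
      also have "\<dots> \<le> norm y * (?N * norm y)"
        by (rule order_trans[OF norm_mult_ineq]) (simp add: norm_star mult_left_mono norm_act_le)
      also have "\<dots> = (sqrt ?N * norm y)\<^sup>2"
        using N0 by (simp add: power_mult_distrib power2_eq_square)
      finally show ?thesis by (rule power2_le_imp_le) (simp add: N0)
    qed
    then have "onorm (act z) \<le> sqrt ?N" by (intro onorm_bound) (simp_all add: N0)
    then have "(onorm (act z))\<^sup>2 \<le> ?N"
      using power_mono[of "onorm (act z)" "sqrt ?N" 2] N0 by (simp add: onorm_pos_le bounded_linear_act)
    moreover have "(cmod (scal z))\<^sup>2 = cmod (scal (star z * z))"
      by (simp add: star_unitization_def times_unitization_def norm_mult power2_eq_square)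
    ultimately show ?thesis
      unfolding norm_unitization_def by (cases "onorm (act z) \<le> cmod (scal z)") (auto simp: max_def)
  qed
  have star_le: "norm z \<le> norm (star z)" for z :: "'a unitization"
  proof (cases "norm z = 0")
    case False
    have "norm z * norm z \<le> norm (star z) * norm z"
      using le[of z] norm_mult_ineq[of "star z" z] by (simp add: power2_eq_square)
    then show ?thesis using False by simp
  qed (simp only: norm_ge_zero)
  have "norm (star z) = norm z" using star_le[of z] star_le[of "star z"] star2[of z] by simp
  then have "norm (star z * z) \<le> (norm z)\<^sup>2"
    using norm_mult_ineq[of "star z" z] by (simp add: power2_eq_square)
  then show "norm (star z * z) = (norm z)\<^sup>2" using le[of z] by simp
qed

end

definition emb :: "'a \<Rightarrow> 'a unitization" where "emb x = Unitize x 0"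

lemma norm_emb: "norm (emb x) = norm (x::'a::cstar_algebra)"
  by (simp add: norm_unitization_def emb_def onorm_act_embed)

lemma emb_simps: "emb x + emb y = emb (x + y)" "emb x * emb y = emb (x * y)"
  for x y :: "'a::cstar_algebra"
  by (simp_all add: emb_def unitization_ops)

lemma closed_ideal_emb:
  fixes I :: "'a::cstar_algebra set"
  assumes I: "closed_two_sided_ideal I"
  shows "closed_two_sided_ideal (emb ` I)"
  unfolding closed_two_sided_ideal_def
proof (intro conjI ballI allI)
  show "closed (emb ` I)"
    unfolding closed_sequential_limits
  proof (intro allI impI, elim conjE)
    fix X and z :: "'a unitization"
    assume X: "\<forall>n. X n \<in> emb ` I" and z: "X \<longlonglongrightarrow> z"
    have "(\<lambda>n. base (X n)) \<longlonglongrightarrow> base z"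
      by (rule bounded_linear.tendsto[OF bounded_linear_base z])
    moreover have "base (X n) \<in> I" for n using X[rule_format, of n] by (auto simp: emb_def)
    ultimately have b: "base z \<in> I"
      by (rule closed_sequentially[OF ideal_closed[OF I], rotated])
    have "(\<lambda>n. scal (X n)) \<longlonglongrightarrow> scal z"
      by (rule bounded_linear.tendsto[OF bounded_linear_scal z])
    moreover have "scal (X n) = 0" for n using X[rule_format, of n] by (auto simp: emb_def)
    ultimately have "scal z = 0" by (simp add: LIMSEQ_const_iff)
    with b show "z \<in> emb ` I" unfolding emb_def by (metis image_eqI unitization.collapse)
  qed
  show "0 \<in> emb ` I" using ideal_zero[OF I] by (auto simp: emb_def zero_unitization_def)
  fix x z and c assume "x \<in> emb ` I"
  then obtain i where i: "i \<in> I" "x = emb i" by blast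
  show "x + y \<in> emb ` I" if "y \<in> emb ` I" for y
    using that i ideal_add[OF I] by (auto simp: emb_simps)
  show "c *\<^sub>C x \<in> emb ` I"
    using i ideal_scaleC[OF I] by (auto simp: emb_def scaleC_unitization_def)
  show "z * x \<in> emb ` I" "x * z \<in> emb ` I"
    using ideal_add[OF I ideal_mult_left[OF I i(1)] ideal_scaleC[OF I i(1)]]
      ideal_add[OF I ideal_mult_right[OF I i(1)] ideal_scaleC[OF I i(1)]]
    unfolding i(2) emb_def times_unitization_def by simp_all
qed

section \<open>Invertibility and spectra in the algebra with adjoined unit\<close>

lemma unit_element_plus_one:
  assumes "unital TYPE('a::cstar_algebra)"
  shows "is_unit_element (fst (plus_one :: 'a \<times> complex))" "snd (plus_one :: 'a \<times> complex) = 0"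
proof -
  have "\<exists>!u::'a. is_unit_element u"
    using assms unfolding unital_def is_unit_element_def by metis
  from theI'[OF this] show "is_unit_element (fst (plus_one :: 'a \<times> complex))"
    using assms by (simp add: plus_one_def)
  show "snd (plus_one :: 'a \<times> complex) = 0" using assms by (simp add: plus_one_def)
qed

text \<open>The unital homomorphism from \<open>A \<times> \<complex>\<close> onto the algebra in which inverses are taken. If \<open>A\<close> has no unit it is
the identity; otherwise it is the projection of the direct sum onto \<open>A\<close>.\<close>

definition to_plus :: "'a::cstar_algebra unitization \<Rightarrow> 'a \<times> complex" where
  "to_plus z = (if unital TYPE('a) then (base z + scal z *\<^sub>C fst (plus_one :: 'a \<times> complex), 0)
                else (base z, scal z))"

lemma to_plus_one: "to_plus 1 = plus_one"
  using unit_element_plus_one(2)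
  by (auto simp: to_plus_def one_unitization_def plus_one_def prod_eq_iff)

lemma to_plus_emb: "to_plus (emb x) = plus_embed x"
  by (simp add: to_plus_def emb_def plus_embed_def)

lemma to_plus_add: "to_plus (z + w) = to_plus z + to_plus w"
  by (simp add: to_plus_def plus_unitization_def scaleC_add_left)

lemma to_plus_diff: "to_plus (z - w) = to_plus z - to_plus w"
  by (simp add: to_plus_def minus_unitization_def scaleC_diff_left)

lemma to_plus_scaleC: "to_plus (c *\<^sub>C z) = plus_scale c (to_plus z)"
  by (simp add: to_plus_def scaleC_unitization_def plus_scale_def scaleC_add_right)

lemma to_plus_mult: "to_plus (z * w) = to_plus z \<odot> to_plus w"
proof (cases "unital TYPE('a)")
  case True
  then have u: "fst plus_one * x = x" "x * fst plus_one = x" for x :: 'a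
    using unit_element_plus_one(1)[OF True] by (simp_all add: is_unit_element_def)
  show ?thesis
    using True by (simp add: to_plus_def plus_mult_def times_unitization_def u distrib_left distrib_right
        scaleC_add_right mult.commute add_ac)
next
  case False
  then show ?thesis by (simp add: to_plus_def plus_mult_def times_unitization_def)
qed

lemma to_plus_carrier: "to_plus z \<in> plus_carrier"
  by (simp add: to_plus_def plus_carrier_def)

lemma to_plus_inj:
  assumes "to_plus z = to_plus w" "scal z = scal w" shows "z = w"
  using assms by (cases z; cases w) (auto simp: to_plus_def split: if_splits)

lemma to_plus_surj:
  fixes p :: "'a::cstar_algebra \<times> complex"
  assumes "p \<in> plus_carrier" "unital TYPE('a) \<or> snd p = d"
  shows "\<exists>w. scal w = d \<and> to_plus w = p"
proof (cases "unital TYPE('a)")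
  case True
  then show ?thesis using assms
    by (intro exI[of _ "Unitize (fst p - d *\<^sub>C fst plus_one) d"])
       (auto simp: to_plus_def plus_carrier_def)
next
  case False
  then show ?thesis using assms
    by (intro exI[of _ "Unitize (fst p) d"]) (auto simp: to_plus_def)
qed

text \<open>An inverse of the image lifts to an inverse of \<open>z\<close>, because the scalar part of the lift can be chosen as the
inverse of that of \<open>z\<close>, and an element is determined by its image and its scalar part.\<close>

lemma is_plus_inverse_to_plus:
  fixes z :: "'a::cstar_algebra unitization"
  assumes c: "scal z \<noteq> 0"
  shows "is_plus_inverse (to_plus z) p \<longleftrightarrow> has_inverse z \<and> p = to_plus (inv_el z)"
proof
  assume p: "is_plus_inverse (to_plus z) p"
  have "unital TYPE('a) \<or> snd p = inverse (scal z)"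
  proof (cases "unital TYPE('a)")
    case False
    then have "scal z * snd p = 1"
      using p by (simp add: is_plus_inverse_def plus_mult_def to_plus_def plus_one_def)
    then show ?thesis using inverse_unique by metis
  qed simp
  then obtain w where w: "scal w = inverse (scal z)" "to_plus w = p"
    using to_plus_surj p unfolding is_plus_inverse_def by blast
  have "z * w = 1" "w * z = 1"
  proof -
    have "to_plus (z * w) = to_plus 1" "to_plus (w * z) = to_plus 1"
      using p w by (simp_all add: to_plus_mult to_plus_one is_plus_inverse_def)
    moreover have "scal (z * w) = scal 1" "scal (w * z) = scal 1"
      using w c by (simp_all add: times_unitization_def one_unitization_def)
    ultimately show "z * w = 1" "w * z = 1" using to_plus_inj by blast+
  qed
  then show "has_inverse z \<and> p = to_plus (inv_el z)"
    using inv_el_unique has_inverseI w by metis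
next
  assume "has_inverse z \<and> p = to_plus (inv_el z)"
  then show "is_plus_inverse (to_plus z) p"
    using inv_el[of z] by (simp add: is_plus_inverse_def to_plus_carrier to_plus_mult[symmetric] to_plus_one)
qed

lemma plus_invertible_to_plus:
  "scal z \<noteq> 0 \<Longrightarrow> plus_invertible (to_plus z) \<longleftrightarrow> has_inverse z"
  by (simp add: plus_invertible_def to_plus_carrier is_plus_inverse_to_plus)

lemma plus_inverse_to_plus:
  "scal z \<noteq> 0 \<Longrightarrow> has_inverse z \<Longrightarrow> plus_inverse (to_plus z) = to_plus (inv_el z)"
  by (simp add: plus_inverse_def is_plus_inverse_to_plus)

lemma scal_one_plus_emb: "scal (1 + emb e) = 1"
  by (simp add: unitization_ops emb_def)

lemma plus_one_plus_embed: "plus_one + plus_embed e = to_plus (1 + emb e)"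
  by (simp add: to_plus_add to_plus_one to_plus_emb)

lemma plus_invertible_one_plus:
  "plus_invertible (plus_one + plus_embed e) \<longleftrightarrow> has_inverse (1 + emb e)"
  by (simp add: plus_one_plus_embed plus_invertible_to_plus scal_one_plus_emb)

lemma conjugate_by_emb:
  assumes "has_inverse (1 + emb e)"
  obtains b where "(1 + emb e) * emb a * inv_el (1 + emb e) = emb b" "conjugate_by e a = plus_embed b"
proof
  let ?w = "(1 + emb e) * emb a * inv_el (1 + emb e)"
  have "scal ?w = 0" by (simp add: times_unitization_def emb_def)
  then show b: "?w = emb (base ?w)" by (metis emb_def unitization.collapse)
  have "conjugate_by e a = to_plus ?w"
    using assms by (simp add: conjugate_by_def plus_one_plus_embed plus_inverse_to_plus scal_one_plus_emb
        to_plus_mult to_plus_emb)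
  then show "conjugate_by e a = plus_embed (base ?w)" by (metis b to_plus_emb)
qed

lemma plus_norm_conjugate_by:
  assumes "has_inverse (1 + emb e)"
  shows "plus_norm (conjugate_by e a) = norm ((1 + emb e) * emb a * inv_el (1 + emb e))"
  using conjugate_by_emb[OF assms, of a] by (metis norm_emb plus_norm_embed)

lemma spectrum_emb:
  assumes "c \<noteq> 0"
  shows "c \<in> spectrum a \<longleftrightarrow> c \<in> spec (emb a)"
proof -
  have "plus_scale c plus_one - plus_embed a = to_plus (c *\<^sub>C 1 - emb a)"
    by (simp add: to_plus_diff to_plus_scaleC to_plus_one to_plus_emb)
  moreover have "scal (c *\<^sub>C 1 - emb a) = c"
    by (simp add: scaleC_unitization_def unitization_ops emb_def)
  ultimately show ?thesis
    using assms by (simp add: spectrum_def spec_def plus_invertible_to_plus)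
qed

section \<open>The spectral radius and the two bounds\<close>

lemma cmod_le_spectral_radius:
  assumes "c \<in> spectrum a" shows "cmod c \<le> spectral_radius a"
  unfolding spectral_radius_def
proof (rule cSup_upper)
  show "bdd_above (insert 0 (cmod ` spectrum a))"
  proof (intro bdd_aboveI)
    fix r assume "r \<in> insert 0 (cmod ` spectrum a)"
    then consider "r = 0" | c where "c \<in> spectrum a" "r = cmod c" "c \<noteq> 0"
      by (metis image_iff insert_iff norm_zero)
    then show "r \<le> norm (emb a)"
    proof cases
      case 2
      then show ?thesis by (simp add: spectrum_emb spec_norm_le)
    qed simp
  qed
qed (use assms in simp)

lemma spectral_radius_nonneg: "0 \<le> spectral_radius a"
proof (cases "spectrum a = {}")
  case False
  then obtain c where "c \<in> spectrum a" by blast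
  then show ?thesis using cmod_le_spectral_radius[of c a] norm_ge_zero order_trans by blast
qed (simp add: spectral_radius_def)

lemma spectral_radius_le:
  assumes "r \<ge> 0" "\<And>c. c \<in> spectrum a \<Longrightarrow> c \<noteq> 0 \<Longrightarrow> cmod c \<le> r"
  shows "spectral_radius a \<le> r"
  unfolding spectral_radius_def
proof (rule cSup_least)
  fix x assume "x \<in> insert 0 (cmod ` spectrum a)"
  then show "x \<le> r" using assms by (metis image_iff insert_iff norm_zero)
qed simp

lemma spec_similar:
  fixes x :: "'a::unital_cstar_algebra"
  assumes x: "has_inverse x" and c: "c \<in> spec a"
  shows "c \<in> spec (x * a * inv_el x)"
proof (rule ccontr)
  note i = inv_el[OF x]
  assume "c \<notin> spec (x * a * inv_el x)"
  then have "has_inverse (c *\<^sub>C 1 - x * a * inv_el x)" by (simp add: spec_def)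
  moreover have "has_inverse (inv_el x)" using i by (intro has_inverseI)
  ultimately have "has_inverse (inv_el x * (c *\<^sub>C 1 - x * a * inv_el x) * x)"
    using x by (intro has_inverse_mult)
  moreover have "inv_el x * (c *\<^sub>C 1 - x * a * inv_el x) * x
      = c *\<^sub>C (inv_el x * x) - (inv_el x * x) * a * (inv_el x * x)"
    by (simp add: left_diff_distrib right_diff_distrib mult.assoc)
  ultimately show False using c by (simp add: i spec_def)
qed

lemma bdd_below_norm_image: "bdd_below (norm ` X)"
  by (rule bdd_belowI[of _ 0]) auto

text \<open>The conjugate has the spectrum of \<open>a\<close>, so its norm is at least \<open>r(a)\<close>. It belongs to \<open>a + I\<close>, because the
inverse \<open>v\<close> of \<open>1 + e\<close> is \<open>1 - e v\<close>.\<close>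

lemma similarity_lower_bound:
  fixes I :: "'a::cstar_algebra set"
  assumes I: "closed_two_sided_ideal I" and e: "e \<in> I" and inv: "has_inverse (1 + emb e)"
  shows "max (spectral_radius a) (quotient_norm (quotient_class I a)) \<le> plus_norm (conjugate_by e a)"
proof -
  define x where "x = 1 + emb e"
  define v where "v = inv_el x"
  have v: "x * v = 1" "v * x = 1" using inv_el[OF inv] by (simp_all add: x_def v_def)
  obtain b where b: "x * emb a * v = emb b" "conjugate_by e a = plus_embed b"
    using conjugate_by_emb[OF inv] unfolding x_def v_def by blast
  have nb: "plus_norm (conjugate_by e a) = norm b" by (simp add: b plus_norm_embed)
  have "spectral_radius a \<le> norm b"
  proof (rule spectral_radius_le)
    fix c assume "c \<in> spectrum a" "c \<noteq> 0"
    then have "c \<in> spec (emb a)" by (simp add: spectrum_emb)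
    then have "c \<in> spec (emb b)"
      using spec_similar[OF inv, of c "emb a"] b(1) by (simp add: x_def v_def)
    then show "cmod c \<le> norm b" using spec_norm_le norm_emb by metis
  qed simp
  moreover have "quotient_norm (quotient_class I a) \<le> norm b"
  proof -
    have J: "closed_two_sided_ideal (emb ` I)" by (rule closed_ideal_emb[OF I])
    have eJ: "emb e \<in> emb ` I" using e by simp
    have v1: "v = 1 - emb e * v" using v(1) by (simp add: x_def distrib_right algebra_simps)
    have "x * emb a * v = emb a * v + emb e * (emb a * v)"
      by (simp add: x_def distrib_right mult.assoc)
    also have "emb a * v = emb a - emb a * (emb e * v)"
      by (subst v1) (simp add: right_diff_distrib)
    finally have "emb b = emb a + (emb e * (emb a - emb a * (emb e * v)) - emb a * (emb e * v))"
      unfolding b(1) by (simp add: algebra_simps)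
    moreover have "emb e * (emb a - emb a * (emb e * v)) - emb a * (emb e * v) \<in> emb ` I"
      by (intro ideal_diff[OF J] ideal_mult_left[OF J] ideal_mult_right[OF J] eJ)
    ultimately obtain i where i: "i \<in> I" "emb b = emb a + emb i" by auto
    then have "b = a + i" by (simp add: emb_simps) (simp add: emb_def)
    then have "b \<in> quotient_class I a" using i(1) by (auto simp: quotient_class_def)
    then show ?thesis unfolding quotient_norm_def by (rule cINF_lower[OF bdd_below_norm_image])
  qed
  ultimately show ?thesis by (simp add: nb)
qed

lemma similarity_upper_bound:
  fixes I :: "'a::cstar_algebra set"
  assumes I: "closed_two_sided_ideal I"
    and r: "spectral_radius a < t" and q: "quotient_norm (quotient_class I a) \<le> t"
  shows "\<exists>e\<in>I. has_inverse (1 + emb e) \<and> plus_norm (conjugate_by e a) \<le> t"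
proof -
  obtain s where s: "spectral_radius a < s" "s < t" using dense[OF r] by blast
  have "\<exists>e\<in>emb ` I. has_inverse (1 + e) \<and> norm ((1 + e) * emb a * inv_el (1 + e)) \<le> t"
  proof (rule similarity_norm_le[OF closed_ideal_emb[OF I]])
    show "0 < s" using s spectral_radius_nonneg[of a] by linarith
    show "s < t" by (rule s)
    show "c \<notin> spec (emb a)" if "s \<le> cmod c" for c
    proof
      assume "c \<in> spec (emb a)"
      moreover have "c \<noteq> 0" using that \<open>0 < s\<close> by auto
      ultimately have "cmod c \<le> spectral_radius a"
        using cmod_le_spectral_radius spectrum_emb by blast
      then show False using that s by simp
    qed
    fix \<epsilon> :: real assume "\<epsilon> > 0"
    then have "(INF x\<in>quotient_class I a. norm x) < t + \<epsilon>" using q by (simp add: quotient_norm_def)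
    moreover have "quotient_class I a \<noteq> {}"
      using ideal_zero[OF I] by (auto simp: quotient_class_def)
    ultimately obtain x where "x \<in> quotient_class I a" "norm x < t + \<epsilon>"
      using bdd_below_norm_image[of "quotient_class I a"] by (auto simp: cINF_less_iff)
    then show "\<exists>i\<in>emb ` I. norm (emb a + i) < t + \<epsilon>"
      by (auto simp: quotient_class_def emb_simps norm_emb)
  qed
  then show ?thesis using plus_norm_conjugate_by by fastforce
qed

theorem corollary3:
  fixes I :: "'a::cstar_algebra set" and a :: 'a
  assumes "closed_two_sided_ideal I"
  shows "max (spectral_radius a) (quotient_norm (quotient_class I a)) =
           (INF e\<in>{e \<in> I. plus_invertible (plus_one + plus_embed e)}. plus_norm (conjugate_by e a))
       \<and> (quotient_norm (quotient_class I a) > spectral_radius a \<longrightarrow>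
           (\<exists>e0\<in>{e \<in> I. plus_invertible (plus_one + plus_embed e)}.
              plus_norm (conjugate_by e0 a) =
              (INF e\<in>{e \<in> I. plus_invertible (plus_one + plus_embed e)}. plus_norm (conjugate_by e a))))"
proof -
  define S where "S = {e \<in> I. plus_invertible (plus_one + plus_embed e)}"
  define g where "g e = plus_norm (conjugate_by e a)" for e
  define M where "M = max (spectral_radius a) (quotient_norm (quotient_class I a))"
  have lower: "M \<le> g e" if "e \<in> S" for e
    using that similarity_lower_bound[OF assms] by (simp add: S_def M_def g_def plus_invertible_one_plus)
  have upper: "\<exists>e\<in>S. g e \<le> t" if "spectral_radius a < t" "M \<le> t" for t
    using similarity_upper_bound[OF assms that(1)] that(2)
    by (auto simp: S_def M_def g_def plus_invertible_one_plus)
  have bdd: "bdd_below (g ` S)" using lower by (intro bdd_belowI2)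
  have "spectral_radius a < M + 1" by (simp add: M_def add_strict_increasing2)
  then have "S \<noteq> {}" using upper[of "M + 1"] by auto
  then have "M \<le> (INF e\<in>S. g e)" using lower by (rule cINF_greatest)
  moreover have "(INF e\<in>S. g e) \<le> M"
  proof (rule dense_ge)
    fix t assume "M < t"
    then obtain e where "e \<in> S" "g e \<le> t" using upper[of t] by (auto simp: M_def)
    then show "(INF e\<in>S. g e) \<le> t" by (rule cINF_lower2[OF bdd])
  qed
  ultimately have eq: "M = (INF e\<in>S. g e)" by simp
  have "\<exists>e0\<in>S. g e0 = (INF e\<in>S. g e)"
    if "spectral_radius a < quotient_norm (quotient_class I a)"
  proof -
    have "spectral_radius a < M" using that by (simp add: M_def)
    then obtain e where "e \<in> S" "g e \<le> M" using upper[of M] by blast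
    then show ?thesis using lower[of e] eq by (intro bexI[of _ e]) simp_all
  qed
  with eq show ?thesis unfolding S_def g_def M_def by blast
qed

end
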